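(* Let $\Omega$ be a class of unital $C^*$-algebras, each of which has the property SP. Then every simple unital $C^*$-algebra $A$ belonging to the class $\mathrm{WTA}\Omega$ has the property SP.
   Context: **Property SP.** A $C^*$-algebra $A$ has the property SP if every non-zero hereditary $C^*$-subalgebra of $A$ contains a non-zero projection. **Cuntz subequivalence.** Let $\mathrm{M}_\infty(A)$ be the algebraic inductive limit of the matrix algebras $\mathrm{M}_n(A)$ under the upper left-hand corner embeddings. For positive $a,b\in \mathrm{M}_\infty(A)$, write $a\precsim b$ if there is a sequence $(v_n)$ in $\mathrm{M}_\infty(A)$ with $\lim_{n\to\infty}\|v_nbv_n^*-a\|=0$. **Notation.** For $x\in A$, a subset $B\subseteq A$ and $\varepsilon>0$, $x\in_\varepsilon B$ means that there is $y\in B$ with $\|x-y\|<\varepsilon$. **The class $\mathrm{WTA}\Omega$.** Let $\Omega$ be a class of unital $C^*$-algebras. A simple unital $C^*$-algebra $A$ belongs to $\mathrm{WTA}\Omega$ if for any $\varepsilon>0$, any finite subset $F\subseteq A$, and any non-zero $a\in A$ with $a\ge 0$, there exist a projection $p\in A$, an element $g\in A$ with $0\le g\le 1$, and a unital $C^*$-subalgebra $B$ of $A$ with $g\in B$, $1_B=p$, and $B\in\Omega$, such that (1) $(p-g)x\in_\varepsilon B$ and $x(p-g)\in_\varepsilon B$ for all $x\in F$; (2) $\|(p-g)x-x(p-g)\|<\varepsilon$ for all $x\in F$; (3) $1-(p-g)\precsim a$; (4) $\|(p-g)a(p-g)\|\ge \|a\|-\varepsilon$. Here the unit $1_B=p$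 of $B$ need not be the unit $1$ of $A$. *)

theory Defs
  imports "HOL-Analysis.Abstract_Metric_Spaces" "HOL-Algebra.Ideal" "HOL-Algebra.Module"
begin

section \<open>C*-algebras\<close>

text \<open>C*-algebras are records on a carrier, in the style of HOL-Algebra, so that a class of
  C*-algebras is a set of such records. The field \<^const>\<open>one\<close> is meaningless
  for an algebra that is not assumed to be unital.\<close>

definition complex_ring :: "complex ring" where
  "complex_ring = \<lparr>carrier = UNIV, mult = (*), one = 1, zero = 0, add = (+)\<rparr>"

record 'a cstar = "(complex, 'a) module" +
  adj :: "'a \<Rightarrow> 'a"
  nrm :: "'a \<Rightarrow> real"

text \<open>The cut-off outside the carrier is needed because \<^locale>\<open>Metric_space\<close> requires
  symmetry and non-negativity on the whole type.\<close>

definition ndist :: "('a, 'm) cstar_scheme \<Rightarrow> 'a \<Rightarrow> 'a \<Rightarrow> real" where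
  "ndist A x y = (if x \<in> carrier A \<and> y \<in> carrier A then nrm A (x \<ominus>\<^bsub>A\<^esub> y) else 0)"

locale cstar_algebra = Module.module complex_ring A for A :: "('a, 'm) cstar_scheme" (structure) +
  assumes mult_closed: "\<lbrakk>x \<in> carrier A; y \<in> carrier A\<rbrakk> \<Longrightarrow> x \<otimes> y \<in> carrier A"
    and mult_assoc: "\<lbrakk>x \<in> carrier A; y \<in> carrier A; z \<in> carrier A\<rbrakk>
      \<Longrightarrow> (x \<otimes> y) \<otimes> z = x \<otimes> (y \<otimes> z)"
    and distr_left: "\<lbrakk>x \<in> carrier A; y \<in> carrier A; z \<in> carrier A\<rbrakk>
      \<Longrightarrow> (x \<oplus> y) \<otimes> z = x \<otimes> z \<oplus> y \<otimes> z"
    and distr_right: "\<lbrakk>x \<in> carrier A; y \<in> carrier A; z \<in> carrier A\<rbrakk>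
      \<Longrightarrow> z \<otimes> (x \<oplus> y) = z \<otimes> x \<oplus> z \<otimes> y"
    and smult_mult_left: "\<lbrakk>x \<in> carrier A; y \<in> carrier A\<rbrakk>
      \<Longrightarrow> (c \<odot> x) \<otimes> y = c \<odot> (x \<otimes> y)"
    and smult_mult_right: "\<lbrakk>x \<in> carrier A; y \<in> carrier A\<rbrakk>
      \<Longrightarrow> x \<otimes> (c \<odot> y) = c \<odot> (x \<otimes> y)"
    and adj_closed: "x \<in> carrier A \<Longrightarrow> adj A x \<in> carrier A"
    and adj_adj: "x \<in> carrier A \<Longrightarrow> adj A (adj A x) = x"
    and adj_add: "\<lbrakk>x \<in> carrier A; y \<in> carrier A\<rbrakk> \<Longrightarrow> adj A (x \<oplus> y) = adj A x \<oplus> adj A y"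
    and adj_smult: "x \<in> carrier A \<Longrightarrow> adj A (c \<odot> x) = cnj c \<odot> adj A x"
    and adj_mult: "\<lbrakk>x \<in> carrier A; y \<in> carrier A\<rbrakk> \<Longrightarrow> adj A (x \<otimes> y) = adj A y \<otimes> adj A x"
    and nrm_nonneg: "x \<in> carrier A \<Longrightarrow> nrm A x \<ge> 0"
    and nrm_eq_0_iff: "x \<in> carrier A \<Longrightarrow> nrm A x = 0 \<longleftrightarrow> x = \<zero>"
    and nrm_triangle: "\<lbrakk>x \<in> carrier A; y \<in> carrier A\<rbrakk> \<Longrightarrow> nrm A (x \<oplus> y) \<le> nrm A x + nrm A y"
    and nrm_smult: "x \<in> carrier A \<Longrightarrow> nrm A (c \<odot> x) = cmod c * nrm A x"
    and nrm_mult: "\<lbrakk>x \<in> carrier A; y \<in> carrier A\<rbrakk> \<Longrightarrow> nrm A (x \<otimes> y) \<le> nrm A x * nrm A y"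
    and nrm_cstar: "x \<in> carrier A \<Longrightarrow> nrm A (adj A x \<otimes> x) = (nrm A x)\<^sup>2"
    and complete: "Metric_space.mcomplete (carrier A) (ndist A)"

locale unital_cstar_algebra = cstar_algebra A + Ring.ring A
  for A :: "('a, 'm) cstar_scheme" (structure)

text \<open>Agreement of the operations is only required on the carrier of \<open>B\<close>; the units may differ. Since \<open>B\<close> is complete,
  its carrier is norm-closed in \<open>A\<close>.\<close>

definition cstar_subalgebra :: "'a cstar \<Rightarrow> 'a cstar \<Rightarrow> bool" where
  "cstar_subalgebra B A \<longleftrightarrow> cstar_algebra B \<and> carrier B \<subseteq> carrier A \<and> \<zero>\<^bsub>B\<^esub> = \<zero>\<^bsub>A\<^esub> \<and>
    (\<forall>x\<in>carrier B. \<forall>y\<in>carrier B. x \<oplus>\<^bsub>B\<^esub> y = x \<oplus>\<^bsub>A\<^esub> y \<and> x \<otimes>\<^bsub>B\<^esub> y = x \<otimes>\<^bsub>A\<^esub> y) \<and>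
    (\<forall>c. \<forall>x\<in>carrier B. c \<odot>\<^bsub>B\<^esub> x = c \<odot>\<^bsub>A\<^esub> x) \<and>
    (\<forall>x\<in>carrier B. adj B x = adj A x \<and> nrm B x = nrm A x)"

definition simple_cstar :: "'a cstar \<Rightarrow> bool" where
  "simple_cstar A \<longleftrightarrow>
    (\<forall>I. ideal I A \<and> closedin (Metric_space.mtopology (carrier A) (ndist A)) I
      \<longrightarrow> I = {\<zero>\<^bsub>A\<^esub>} \<or> I = carrier A)"

definition positive :: "'a cstar \<Rightarrow> 'a \<Rightarrow> bool" where
  "positive A a \<longleftrightarrow> (\<exists>x\<in>carrier A. a = adj A x \<otimes>\<^bsub>A\<^esub> x)"

definition cstar_le :: "'a cstar \<Rightarrow> 'a \<Rightarrow> 'a \<Rightarrow> bool" where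
  "cstar_le A a b \<longleftrightarrow> a \<in> carrier A \<and> b \<in> carrier A \<and> positive A (b \<ominus>\<^bsub>A\<^esub> a)"

definition projection :: "'a cstar \<Rightarrow> 'a \<Rightarrow> bool" where
  "projection A p \<longleftrightarrow> p \<in> carrier A \<and> adj A p = p \<and> p \<otimes>\<^bsub>A\<^esub> p = p"

section \<open>Property SP\<close>

definition hereditary_subalgebra :: "'a cstar \<Rightarrow> 'a cstar \<Rightarrow> bool" where
  "hereditary_subalgebra H A \<longleftrightarrow> cstar_subalgebra H A \<and>
    (\<forall>x\<in>carrier A. \<forall>y\<in>carrier H.
      cstar_le A \<zero>\<^bsub>A\<^esub> x \<and> cstar_le A x y \<longrightarrow> x \<in> carrier H)"

definition property_SP :: "'a cstar \<Rightarrow> bool" where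
  "property_SP A \<longleftrightarrow>
    (\<forall>H. hereditary_subalgebra H A \<and> carrier H \<noteq> {\<zero>\<^bsub>A\<^esub>}
      \<longrightarrow> (\<exists>q\<in>carrier H. projection A q \<and> q \<noteq> \<zero>\<^bsub>A\<^esub>))"

section \<open>Cuntz subequivalence\<close>

text \<open>The union of the matrix algebras over \<open>A\<close> along the upper left-hand corner embeddings is
  realised as the infinite matrices supported in some finite upper left-hand corner.\<close>

definition Minf :: "'a cstar \<Rightarrow> (nat \<Rightarrow> nat \<Rightarrow> 'a) set" where
  "Minf A = {m. (\<forall>i j. m i j \<in> carrier A) \<and>
    (\<exists>n. \<forall>i j. i \<ge> n \<or> j \<ge> n \<longrightarrow> m i j = \<zero>\<^bsub>A\<^esub>)}"

definition Minf_mult :: "'a cstar \<Rightarrow> (nat \<Rightarrow> nat \<Rightarrow> 'a) \<Rightarrow> (nat \<Rightarrow> nat \<Rightarrow> 'a) \<Rightarrow> (nat \<Rightarrow> nat \<Rightarrow> 'a)" where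
  "Minf_mult A m l =
    (\<lambda>i j. finsum A (\<lambda>k. m i k \<otimes>\<^bsub>A\<^esub> l k j) {k. m i k \<noteq> \<zero>\<^bsub>A\<^esub>})"

definition Minf_adj :: "'a cstar \<Rightarrow> (nat \<Rightarrow> nat \<Rightarrow> 'a) \<Rightarrow> (nat \<Rightarrow> nat \<Rightarrow> 'a)" where
  "Minf_adj A m = (\<lambda>i j. adj A (m j i))"

definition Minf_minus :: "'a cstar \<Rightarrow> (nat \<Rightarrow> nat \<Rightarrow> 'a) \<Rightarrow> (nat \<Rightarrow> nat \<Rightarrow> 'a) \<Rightarrow> (nat \<Rightarrow> nat \<Rightarrow> 'a)" where
  "Minf_minus A m l = (\<lambda>i j. m i j \<ominus>\<^bsub>A\<^esub> l i j)"

definition corner :: "'a cstar \<Rightarrow> 'a \<Rightarrow> (nat \<Rightarrow> nat \<Rightarrow> 'a)" where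
  "corner A a = (\<lambda>i j. if i = 0 \<and> j = 0 then a else \<zero>\<^bsub>A\<^esub>)"

text \<open>The C*-norm of a matrix is its operator norm on finitely supported columns over \<open>A\<close>, normed
  as a Hilbert \<open>A\<close>-module by \<open>\<parallel>x\<parallel>\<^sup>2 = \<parallel>\<Sum>i. x\<^sub>i* x\<^sub>i\<parallel>\<close>. The matrices of size \<open>n\<close> act faithfully by adjointable
  operators, so this restricts to the unique C*-norm on each of these matrix algebras.\<close>

definition cols :: "'a cstar \<Rightarrow> (nat \<Rightarrow> 'a) set" where
  "cols A = {x. (\<forall>i. x i \<in> carrier A) \<and> finite {i. x i \<noteq> \<zero>\<^bsub>A\<^esub>}}"

definition col_nrm :: "'a cstar \<Rightarrow> (nat \<Rightarrow> 'a) \<Rightarrow> real" where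
  "col_nrm A x =
    sqrt (nrm A (finsum A (\<lambda>i. adj A (x i) \<otimes>\<^bsub>A\<^esub> x i) {i. x i \<noteq> \<zero>\<^bsub>A\<^esub>}))"

definition Minf_apply :: "'a cstar \<Rightarrow> (nat \<Rightarrow> nat \<Rightarrow> 'a) \<Rightarrow> (nat \<Rightarrow> 'a) \<Rightarrow> (nat \<Rightarrow> 'a)" where
  "Minf_apply A m x = (\<lambda>i. finsum A (\<lambda>j. m i j \<otimes>\<^bsub>A\<^esub> x j) {j. x j \<noteq> \<zero>\<^bsub>A\<^esub>})"

definition Minf_nrm :: "'a cstar \<Rightarrow> (nat \<Rightarrow> nat \<Rightarrow> 'a) \<Rightarrow> real" where
  "Minf_nrm A m = (SUP x\<in>{x\<in>cols A. col_nrm A x \<le> 1}. col_nrm A (Minf_apply A m x))"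

definition Minf_positive :: "'a cstar \<Rightarrow> (nat \<Rightarrow> nat \<Rightarrow> 'a) \<Rightarrow> bool" where
  "Minf_positive A a \<longleftrightarrow> (\<exists>x\<in>Minf A. a = Minf_mult A (Minf_adj A x) x)"

definition cuntz_sub :: "'a cstar \<Rightarrow> (nat \<Rightarrow> nat \<Rightarrow> 'a) \<Rightarrow> (nat \<Rightarrow> nat \<Rightarrow> 'a) \<Rightarrow> bool" where
  "cuntz_sub A a b \<longleftrightarrow> Minf_positive A a \<and> Minf_positive A b \<and>
    (\<exists>v :: nat \<Rightarrow> nat \<Rightarrow> nat \<Rightarrow> 'a. (\<forall>n. v n \<in> Minf A) \<and>
      (\<lambda>n. Minf_nrm A (Minf_minus A (Minf_mult A (Minf_mult A (v n) b) (Minf_adj A (v n))) a))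
        \<longlonglongrightarrow> 0)"

section \<open>The class WTA\<close>

definition near :: "'a cstar \<Rightarrow> 'a \<Rightarrow> real \<Rightarrow> 'a set \<Rightarrow> bool" where
  "near A x \<epsilon> S \<longleftrightarrow> (\<exists>y\<in>S. nrm A (x \<ominus>\<^bsub>A\<^esub> y) < \<epsilon>)"

definition WTA :: "'a cstar set \<Rightarrow> 'a cstar set" where
  "WTA \<Omega> = {A. unital_cstar_algebra A \<and> simple_cstar A \<and>
    (\<forall>\<epsilon>>0. \<forall>F a. finite F \<and> F \<subseteq> carrier A \<and> a \<in> carrier A \<and> a \<noteq> \<zero>\<^bsub>A\<^esub> \<and> positive A a \<longrightarrow>
      (\<exists>p g. \<exists>B\<in>\<Omega>. projection A p \<and> g \<in> carrier A \<and>
        cstar_le A \<zero>\<^bsub>A\<^esub> g \<and> cstar_le A g \<one>\<^bsub>A\<^esub> \<and>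
        unital_cstar_algebra B \<and> cstar_subalgebra B A \<and> g \<in> carrier B \<and> \<one>\<^bsub>B\<^esub> = p \<and>
        (\<forall>x\<in>F. near A ((p \<ominus>\<^bsub>A\<^esub> g) \<otimes>\<^bsub>A\<^esub> x) \<epsilon> (carrier B) \<and>
               near A (x \<otimes>\<^bsub>A\<^esub> (p \<ominus>\<^bsub>A\<^esub> g)) \<epsilon> (carrier B)) \<and>
        (\<forall>x\<in>F. nrm A ((p \<ominus>\<^bsub>A\<^esub> g) \<otimes>\<^bsub>A\<^esub> x \<ominus>\<^bsub>A\<^esub> x \<otimes>\<^bsub>A\<^esub> (p \<ominus>\<^bsub>A\<^esub> g)) < \<epsilon>) \<and>
        cuntz_sub A (corner A (\<one>\<^bsub>A\<^esub> \<ominus>\<^bsub>A\<^esub> (p \<ominus>\<^bsub>A\<^esub> g))) (corner A a) \<and>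
        nrm A ((p \<ominus>\<^bsub>A\<^esub> g) \<otimes>\<^bsub>A\<^esub> a \<otimes>\<^bsub>A\<^esub> (p \<ominus>\<^bsub>A\<^esub> g)) \<ge> nrm A a - \<epsilon>))}"

end

theory Submission
  imports Defs
begin

text \<open>Let \<open>H\<close> be a non-zero hereditary subalgebra of \<open>A\<close>. Choose a self-adjoint \<open>y\<close> in \<open>H\<close> with
  \<open>\<parallel>y\<parallel> = 1\<close>, put \<open>a = y\<^sup>2\<close>, and apply the definition of the class to \<open>F = {y}\<close> and \<open>a\<close>. With
  \<open>c = p - g\<close> this gives \<open>x \<in> B\<close> close to \<open>y c\<close>, so that \<open>b = x\<^sup>* x\<close> is close to \<open>c a c\<close> and has norm
  \<open>\<beta>\<close> close to 1. Property SP of \<open>B\<close> gives a non-zero projection \<open>q \<in> B\<close> in the spectral subspace of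
  \<open>b\<close> for \<open>[\<beta>/2, \<beta>]\<close>. Then \<open>q c a c q\<close> is invertible in the corner of \<open>q\<close>, hence \<open>q\<close> is equivalent to
  a projection of the form \<open>y m y\<close>, which lies in \<open>H\<close> because it is dominated by a multiple of
  \<open>y\<^sup>2\<close>.

  Positivity is treated through the norm, without spectra: a self-adjoint \<open>a\<close> counts as positive if
  \<open>\<parallel>t - a\<parallel> \<le> t\<close> for some \<open>t \<ge> 0\<close>.\<close>

section \<open>C*-algebras as a type class\<close>

text \<open>The complex scalars are the real ones together with the central element \<open>iu = \<i> 1\<close>. The unit is
  only required to form a monoid, since \<open>ring_1\<close> would exclude the zero algebra.\<close>

class ucstar = real_normed_algebra + banach + monoid_mult +
  fixes star :: "'a \<Rightarrow> 'a" and iu :: 'a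
  assumes star_star [simp]: "star (star x) = x"
    and star_add [simp]: "star (x + y) = star x + star y"
    and star_scaleR [simp]: "star (scaleR r x) = scaleR r (star x)"
    and star_mult [simp]: "star (x * y) = star y * star x"
    and norm_star_mult: "norm (star x * x) = (norm x)\<^sup>2"
    and iu_commute: "iu * x = x * iu"
    and iu_iu: "iu * iu = - 1"
    and star_iu [simp]: "star iu = - iu"

lemma star_minus [simp]: "star (- x :: 'a::ucstar) = - star x"
  using star_scaleR[of "-1" x] by simp

lemma star_diff [simp]: "star (x - y :: 'a::ucstar) = star x - star y"
  using star_add[of x "- y"] by simp

lemma star_zero [simp]: "star (0::'a::ucstar) = 0"
  using star_scaleR[of 0 "0::'a"] by simp

lemma star_one [simp]: "star (1::'a::ucstar) = 1"
  by (metis star_star star_mult mult_1_left mult_1_right)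

lemma norm_star [simp]: "norm (star x) = norm (x::'a::ucstar)"
proof -
  have le: "norm x \<le> norm (star x)" for x :: 'a
  proof (cases "norm x = 0")
    case False
    have "norm x * norm x \<le> norm (star x) * norm x"
      using norm_mult_ineq[of "star x" x] by (simp add: norm_star_mult power2_eq_square)
    then show ?thesis using False by simp
  qed simp
  from le[of x] le[of "star x"] show ?thesis by simp
qed

lemma norm_mult_star: "norm (x * star x) = (norm (x::'a::ucstar))\<^sup>2"
  using norm_star_mult[of "star x"] by simp

lemma norm_square_sa: "star x = x \<Longrightarrow> norm (x * x) = (norm (x::'a::ucstar))\<^sup>2"
  using norm_star_mult[of x] by simp

text \<open>Equality fails in the zero algebra, which the class admits; from
  \<open>norm 1 = (norm 1)^2\<close> the norm is 0 or 1.\<close>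

lemma norm_one_le: "norm (1::'a::ucstar) \<le> 1"
proof -
  have "norm (1::'a) = (norm (1::'a))\<^sup>2" using norm_star_mult[of "1::'a"] by simp
  then show ?thesis by (metis order_refl mult_cancel_left2 power2_eq_square zero_le_one)
qed

lemma mult_star_eq_0: "star x * x = 0 \<Longrightarrow> x = (0::'a::ucstar)"
  using norm_star_mult[of x] by simp

lemma tendsto_star: "(f \<longlongrightarrow> (l::'a::ucstar)) F \<Longrightarrow> ((\<lambda>x. star (f x)) \<longlongrightarrow> star l) F"
proof -
  assume f: "(f \<longlongrightarrow> l) F"
  have "bounded_linear (star :: 'a \<Rightarrow> 'a)"
    by (rule bounded_linear_intro[of _ 1]) auto
  from bounded_linear.tendsto[OF this f] show ?thesis .
qed

subsection \<open>Square roots\<close>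

text \<open>Iteration towards a fixed point \<open>v = (u + v^2)/2\<close>, which is the equation
  \<open>(1 - v)^2 = 1 - u\<close>. The real iteration for \<open>u = 1\<close> is the majorant of
  all the others.\<close>

primrec sqrt_iter :: "'a::real_normed_algebra \<Rightarrow> nat \<Rightarrow> 'a" where
  "sqrt_iter u 0 = 0"
| "sqrt_iter u (Suc n) = (1/2) *\<^sub>R (u + sqrt_iter u n * sqrt_iter u n)"

lemma sqrt_iter_real_bounds: "0 \<le> sqrt_iter (1::real) n \<and> sqrt_iter (1::real) n \<le> 1"
proof (induction n)
  case (Suc n)
  then have "sqrt_iter (1::real) n * sqrt_iter 1 n \<le> 1" by (simp add: mult_le_one)
  with Suc show ?case by simp
qed simp

lemma sqrt_iter_real_mono: "sqrt_iter (1::real) n \<le> sqrt_iter 1 (Suc n)"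
proof -
  have "0 \<le> (1 - sqrt_iter (1::real) n)\<^sup>2" by simp
  then show ?thesis by (simp add: power2_eq_square algebra_simps)
qed

lemma convergent_sqrt_iter_real: "convergent (sqrt_iter (1::real))"
  by (intro Bseq_monoseq_convergent BseqI'[where K=1])
     (auto simp: sqrt_iter_real_bounds monoseq_Suc sqrt_iter_real_mono simp del: sqrt_iter.simps)

lemma norm_sqrt_iter:
  fixes u :: "'a::real_normed_algebra"
  assumes "norm u \<le> 1"
  shows "norm (sqrt_iter u n) \<le> sqrt_iter 1 n"
proof (induction n)
  case (Suc n)
  have "norm (sqrt_iter u n * sqrt_iter u n) \<le> sqrt_iter 1 n * sqrt_iter 1 n"
    using Suc by (meson mult_mono norm_mult_ineq norm_ge_zero order_trans)
  then have "norm (u + sqrt_iter u n * sqrt_iter u n) \<le> 1 + sqrt_iter 1 n * sqrt_iter 1 n"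
    using assms norm_triangle_ineq[of u "sqrt_iter u n * sqrt_iter u n"] by linarith
  then show ?case by simp
qed simp

text \<open>Factoring \<open>x^2 - y^2\<close> as \<open>x (x - y) + (x - y) y\<close> gives the
  same recursive bound as for the real numbers, so the increments are dominated by those of the real
  majorant.\<close>

lemma norm_sqrt_iter_diff:
  fixes u :: "'a::real_normed_algebra"
  assumes u: "norm u \<le> 1"
  shows "norm (sqrt_iter u (Suc n) - sqrt_iter u n) \<le> sqrt_iter 1 (Suc n) - sqrt_iter 1 n"
proof (induction n)
  case 0
  show ?case using u by simp
next
  case (Suc n)
  define x y where "x = sqrt_iter u (Suc n)" and "y = sqrt_iter u n"
  define s t :: real where "s = sqrt_iter 1 (Suc n)" and "t = sqrt_iter 1 n"
  have xy: "norm x \<le> s" "norm y \<le> t" "norm (x - y) \<le> s - t"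
    using norm_sqrt_iter[OF u] Suc unfolding x_def y_def s_def t_def by blast+
  have *: "x * x - y * y = x * (x - y) + (x - y) * y" by (simp add: algebra_simps)
  have "norm (x * (x - y)) \<le> s * (s - t)" "norm ((x - y) * y) \<le> (s - t) * t"
    using xy by (meson mult_mono norm_mult_ineq norm_ge_zero order_trans)+
  then have "norm (x * x - y * y) \<le> s * (s - t) + (s - t) * t"
    unfolding * using norm_triangle_le add_mono by blast
  also have "\<dots> = s * s - t * t" by (simp add: algebra_simps)
  finally have "norm (x * x - y * y) \<le> s * s - t * t" .
  moreover have "sqrt_iter u (Suc (Suc n)) - sqrt_iter u (Suc n) = (1/2) *\<^sub>R (x * x - y * y)"
    unfolding x_def y_def by (simp add: algebra_simps)
  moreover have "sqrt_iter (1::real) (Suc (Suc n)) - sqrt_iter 1 (Suc n) = (s * s - t * t) / 2"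
    unfolding s_def t_def by (simp add: algebra_simps)
  ultimately show ?case by (simp del: sqrt_iter.simps)
qed

text \<open>The majorizing increments telescope, so two iterates are no further apart than the
  corresponding real ones, and these converge as a bounded monotone sequence.\<close>

lemma convergent_sqrt_iter:
  fixes u :: "'a::{real_normed_algebra, banach}"
  assumes u: "norm u \<le> 1"
  shows "convergent (sqrt_iter u)"
proof -
  have "norm (sqrt_iter u (m + k) - sqrt_iter u m) \<le> sqrt_iter 1 (m + k) - sqrt_iter 1 m" for m k
  proof (induction k)
    case (Suc k)
    have "norm (sqrt_iter u (m + Suc k) - sqrt_iter u m)
        \<le> norm (sqrt_iter u (Suc (m + k)) - sqrt_iter u (m + k)) + norm (sqrt_iter u (m + k) - sqrt_iter u m)"
      by (metis add_Suc_right norm_diff_triangle_le order_refl)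
    also have "\<dots> \<le> (sqrt_iter 1 (Suc (m + k)) - sqrt_iter 1 (m + k)) + (sqrt_iter 1 (m + k) - sqrt_iter 1 m)"
      by (intro add_mono norm_sqrt_iter_diff[OF u] Suc)
    finally show ?case by (simp del: sqrt_iter.simps)
  qed simp
  then have *: "norm (sqrt_iter u n - sqrt_iter u m) \<le> sqrt_iter 1 n - sqrt_iter 1 m" if "m \<le> n" for m n
    using that by (metis le_Suc_ex)
  have "Cauchy (sqrt_iter (1::real))"
    using convergent_sqrt_iter_real by (simp add: Cauchy_convergent_iff)
  have "Cauchy (sqrt_iter u)"
    unfolding Cauchy_altdef2
  proof (intro allI impI)
    fix e :: real
    assume "e > 0"
    then obtain N where N: "\<forall>n\<ge>N. dist (sqrt_iter (1::real) n) (sqrt_iter 1 N) < e"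
      using \<open>Cauchy (sqrt_iter (1::real))\<close> unfolding Cauchy_altdef2 by blast
    show "\<exists>N. \<forall>n\<ge>N. dist (sqrt_iter u n) (sqrt_iter u N) < e"
      using N *[of N] unfolding dist_norm real_norm_def
      by (intro exI[of _ N]) (smt (verit))
  qed
  then show ?thesis by (simp add: Cauchy_convergent_iff)
qed

text \<open>\<open>1 - v\<close> is a square root of \<open>1 - u\<close>. Every iterate commutes
  with all elements that commute with \<open>u\<close>, and so does the limit; this clause stands in
  for the functional calculus later on.\<close>

lemma sqrt_one_minus:
  fixes u :: "'a::ucstar"
  assumes u: "norm u \<le> 1" "star u = u"
  obtains v where "star v = v" "norm v \<le> 1" "(1 - v) * (1 - v) = 1 - u"
    "\<And>x. x * u = u * x \<Longrightarrow> x * v = v * x"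
proof -
  obtain v where v: "sqrt_iter u \<longlonglongrightarrow> v"
    using convergent_sqrt_iter[OF u(1)] convergent_def by blast
  have sa: "star (sqrt_iter u n) = sqrt_iter u n" for n
    by (induction n) (use u in auto)
  have 1: "star v = v"
    using LIMSEQ_unique[OF tendsto_star[OF v]] v sa by auto
  have "norm (sqrt_iter u n) \<le> 1" for n
    using norm_sqrt_iter[OF u(1)] sqrt_iter_real_bounds order_trans by blast
  then have 2: "norm v \<le> 1"
    using LIMSEQ_le_const2[OF tendsto_norm[OF v]] by blast
  have "(\<lambda>n. sqrt_iter u (Suc n)) \<longlonglongrightarrow> (1/2) *\<^sub>R (u + v * v)"
    unfolding sqrt_iter.simps by (intro tendsto_intros v)
  then have "v = (1/2) *\<^sub>R (u + v * v)"
    using LIMSEQ_unique LIMSEQ_Suc[OF v] by blast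
  then have "2 *\<^sub>R v = u + v * v"
    by (metis scaleR_scaleR mult.commute nonzero_eq_divide_eq scaleR_one zero_neq_numeral times_divide_eq_left)
  then have 3: "(1 - v) * (1 - v) = 1 - u"
    by (simp add: algebra_simps scaleR_2)
  have 4: "x * v = v * x" if x: "x * u = u * x" for x
  proof -
    have "x * sqrt_iter u n = sqrt_iter u n * x" for n
    proof (induction n)
      case (Suc n)
      then show ?case using x by (simp add: algebra_simps) (metis mult.assoc)
    qed simp
    moreover have "(\<lambda>n. x * sqrt_iter u n) \<longlonglongrightarrow> x * v" "(\<lambda>n. sqrt_iter u n * x) \<longlonglongrightarrow> v * x"
      by (intro tendsto_intros v)+
    ultimately show ?thesis using LIMSEQ_unique by auto
  qed
  from 1 2 3 4 that show ?thesis by blast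
qed

subsection \<open>Positivity in the norm\<close>

text \<open>For a real number \<open>a\<close> the condition says \<open>0 <= a <= 2t\<close>. In
  this form closure under sums is the triangle inequality, and square roots come from the iteration
  above.\<close>

definition posi :: "'a::ucstar \<Rightarrow> bool" where
  "posi a \<longleftrightarrow> star a = a \<and> (\<exists>t\<ge>0. norm (t *\<^sub>R 1 - a) \<le> t)"

lemma posi_sa: "posi a \<Longrightarrow> star a = a"
  by (simp add: posi_def)

lemma posiI: "star a = a \<Longrightarrow> norm (t *\<^sub>R 1 - a) \<le> t \<Longrightarrow> posi a"
  unfolding posi_def using norm_ge_zero order_trans by blast

lemma posi_one_minus: "star a = a \<Longrightarrow> norm a \<le> t \<Longrightarrow> posi (t *\<^sub>R 1 - a)"
  by (rule posiI[of _ t]) auto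

lemma posi_zero [simp]: "posi 0"
  by (rule posiI[of _ 0]) auto

lemma posi_add: "posi a \<Longrightarrow> posi b \<Longrightarrow> posi (a + b)"
proof -
  assume ab: "posi a" "posi b"
  then obtain s t where "norm (s *\<^sub>R 1 - a) \<le> s" "norm (t *\<^sub>R 1 - b) \<le> t"
    unfolding posi_def by blast
  then have "norm ((s *\<^sub>R 1 - a) + (t *\<^sub>R 1 - b)) \<le> s + t"
    by (meson add_mono norm_triangle_le)
  then show ?thesis using ab by (intro posiI[of _ "s + t"]) (auto simp: posi_sa algebra_simps)
qed

lemma posi_scaleR: "posi a \<Longrightarrow> 0 \<le> r \<Longrightarrow> posi (r *\<^sub>R a)"
proof -
  assume a: "posi a" "0 \<le> r"
  then obtain s where "norm (s *\<^sub>R 1 - a) \<le> s" unfolding posi_def by blast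
  then have "norm (r *\<^sub>R (s *\<^sub>R 1 - a)) \<le> r * s" using a by (simp add: mult_left_mono)
  then show ?thesis using a by (intro posiI[of _ "r * s"]) (auto simp: posi_sa algebra_simps)
qed

lemma posi_sqrt:
  assumes "posi a"
  obtains w where "posi w" "w * w = a" "\<And>x. x * a = a * x \<Longrightarrow> x * w = w * x"
proof -
  from assms obtain s where s: "norm (s *\<^sub>R 1 - a) \<le> s" "0 \<le> s" unfolding posi_def by blast
  show ?thesis
  proof (cases "s = 0")
    case True
    then have "a = 0" using s by simp
    then show ?thesis using that[of 0] by simp
  next
    case False
    \<comment> \<open>With this \<open>u\<close> in the unit ball, \<open>a = s (1 - u)\<close>;
      hence \<open>sqrt s\<close> times a root of \<open>1 - u\<close> is a root of
      \<open>a\<close>.\<close>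
    define u where "u = 1 - (1/s) *\<^sub>R a"
    have "u = (1/s) *\<^sub>R (s *\<^sub>R 1 - a)" using False by (simp add: u_def algebra_simps)
    then have "norm u \<le> 1" using s False by (simp add: divide_simps)
    moreover have "star u = u" using assms by (simp add: u_def posi_sa)
    ultimately obtain v where v: "star v = v" "norm v \<le> 1" "(1 - v) * (1 - v) = 1 - u"
        "\<And>x. x * u = u * x \<Longrightarrow> x * v = v * x" using sqrt_one_minus by blast
    define w where "w = sqrt s *\<^sub>R (1 - v)"
    have "posi w" unfolding w_def using v posi_one_minus[of v 1] s by (intro posi_scaleR) auto
    moreover have "w * w = a"
      using s False v(3) by (simp add: w_def u_def)
    moreover have "x * w = w * x" if "x * a = a * x" for x
      using v(4)[of x] that by (simp add: w_def u_def algebra_simps)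
    ultimately show ?thesis using that by blast
  qed
qed

text \<open>The element \<open>w + i v\<close> is unitary and \<open>w\<close> is its real part.\<close>

lemma norm_le_1_of_sum_squares:
  fixes w v :: "'a::ucstar"
  assumes sa: "star w = w" "star v = v" and c: "w * v = v * w" and s: "w * w + v * v = 1"
  shows "norm w \<le> 1"
proof -
  define u where "u = w + iu * v"
  have su: "star u = w - iu * v" using sa by (simp add: u_def iu_commute)
  have "iu * v * (iu * v) = (iu * iu) * (v * v)"
    by (metis iu_commute mult.assoc)
  then have i: "iu * (v * (iu * v)) = - (v * v)" by (simp add: iu_iu mult.assoc)
  have "w * (iu * v) = iu * v * w"
    by (metis iu_commute mult.assoc c)
  then have "star u * u = 1"
    unfolding su using s by (simp add: u_def algebra_simps i add_eq_0_iff2)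
  then have "(norm u)\<^sup>2 \<le> 1"
    using norm_star_mult[of u] norm_one_le by metis
  then have "norm u \<le> 1" by (simp add: power_le_one_iff abs_square_le_1)
  moreover have "w = (1/2) *\<^sub>R (u + star u)" by (simp add: su) (simp add: u_def flip: scaleR_2)
  ultimately show ?thesis
    using norm_triangle_ineq[of u "star u"] by simp
qed

text \<open>Scale \<open>a\<close> to \<open>b\<close> in the unit ball and let \<open>1 - v\<close>
  be a root of \<open>1 - b^2\<close>. Then \<open>(1 - v)^2 + b^2 = 1\<close> with commuting terms,
  so \<open>1 - v\<close> has norm at most 1. Therefore
  \<open>norm (1 - b^2) = (norm (1 - v))^2 <= 1\<close>, which is positivity of \<open>b^2\<close>
  with \<open>t = 1\<close>.\<close>

lemma posi_square:
  fixes a :: "'a::ucstar"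
  assumes sa: "star a = a"
  shows "posi (a * a)"
proof -
  define r where "r = norm a + 1"
  have r: "r > 0" by (simp add: r_def add_nonneg_pos)
  define b where "b = (1/r) *\<^sub>R a"
  have b: "norm b \<le> 1" "star b = b" using sa r by (auto simp: b_def r_def)
  then have "norm (b * b) \<le> 1" by (metis norm_square_sa norm_ge_zero power_le_one)
  then obtain v where v: "star v = v" "norm v \<le> 1" "(1 - v) * (1 - v) = 1 - b * b"
      "\<And>x. x * (b * b) = b * b * x \<Longrightarrow> x * v = v * x"
    using sqrt_one_minus[of "b * b"] b(2) by (metis star_mult)
  have bv: "b * v = v * b" using v(4) by (simp add: mult.assoc)
  have "norm (1 - v) \<le> 1"
    by (rule norm_le_1_of_sum_squares[of _ b]) (use v b bv in \<open>auto simp: algebra_simps\<close>)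
  then have "norm (1 - b * b) \<le> 1"
    using v by (metis norm_ge_zero norm_square_sa power_le_one star_diff star_one)
  then have "posi (b * b)" using b by (intro posiI[of _ 1]) auto
  then have "posi (r\<^sup>2 *\<^sub>R (b * b))" by (intro posi_scaleR) auto
  then show ?thesis using r by (simp add: b_def power2_eq_square)
qed

text \<open>The roots \<open>w\<close> and \<open>v\<close> commute as well, so \<open>w * v\<close>
  is self-adjoint and \<open>a * b\<close> is its square.\<close>

lemma posi_mult:
  assumes "posi a" "posi b" "a * b = b * a"
  shows "posi (a * b)"
proof -
  obtain w where w: "posi w" "w * w = a" "\<And>x. x * a = a * x \<Longrightarrow> x * w = w * x"
    using posi_sqrt[OF assms(1)] by metis
  obtain v where v: "posi v" "v * v = b" "\<And>x. x * b = b * x \<Longrightarrow> x * v = v * x"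
    using posi_sqrt[OF assms(2)] by metis
  have "b * w = w * b" using w(3) assms(3) by simp
  then have wv: "w * v = v * w" using v(3) by simp
  then have "(w * v) * (w * v) = a * b"
    by (metis w(2) v(2) mult.assoc)
  moreover have "star (w * v) = w * v" using wv by (simp add: posi_sa[OF w(1)] posi_sa[OF v(1)])
  ultimately show ?thesis using posi_square by metis
qed

text \<open>For \<open>t > 0\<close> the decomposition \<open>a/t + (t - a)/t = 1\<close> is a sum
  of squares of commuting self-adjoint roots, so the root of \<open>a/t\<close> lies in the unit
  ball.\<close>

lemma posi_le_norm:
  assumes a: "posi a" and ab: "posi (t *\<^sub>R 1 - a)" and t: "0 \<le> t"
  shows "norm a \<le> t"
proof -
  have *: "norm a \<le> t" if t: "t > 0" "posi (t *\<^sub>R 1 - a)" for t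
  proof -
    obtain w where w: "posi w" "w * w = a" "\<And>x. x * a = a * x \<Longrightarrow> x * w = w * x"
      using posi_sqrt[OF assms(1)] by metis
    obtain v where v: "posi v" "v * v = t *\<^sub>R 1 - a"
      "\<And>x. x * (t *\<^sub>R 1 - a) = (t *\<^sub>R 1 - a) * x \<Longrightarrow> x * v = v * x"
      using posi_sqrt[OF t(2)] by metis
    have "w * a = a * w" by (simp add: mult.assoc flip: w(2))
    then have "w * v = v * w" by (intro v(3)) (simp add: algebra_simps)
    moreover have "(1/t) *\<^sub>R (w * w) + (1/t) *\<^sub>R (v * v) = 1"
      using t(1) by (simp add: w(2) v(2) flip: scaleR_add_right)
    ultimately have "norm ((1/sqrt t) *\<^sub>R w) \<le> 1"
      using t(1) posi_sa[OF w(1)] posi_sa[OF v(1)]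
      by (intro norm_le_1_of_sum_squares[of _ "(1/sqrt t) *\<^sub>R v"]) auto
    then have "norm w \<le> sqrt t" using t by (simp add: divide_simps)
    then have "(norm w)\<^sup>2 \<le> (sqrt t)\<^sup>2" by (intro power_mono) auto
    then show ?thesis
      using norm_square_sa[OF posi_sa[OF w(1)]] t(1) unfolding w(2) by simp
  qed
  \<comment> \<open>The case \<open>t = 0\<close> is reached by replacing \<open>t\<close> with
    \<open>t + e\<close>.\<close>
  show ?thesis
  proof (rule field_le_epsilon)
    fix e :: real
    assume e: "0 < e"
    have "posi (e *\<^sub>R 1 - (0::'a))"
      using e by (intro posi_one_minus) auto
    from posi_add[OF this ab] have "posi ((t + e) *\<^sub>R 1 - a)"
      by (simp add: algebra_simps)
    then show "norm a \<le> t + e"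
      using t e by (intro *) auto
  qed
qed

lemma posi_norm_mono:
  assumes "posi a" "posi (b - a)"
  shows "norm a \<le> norm b"
proof (rule posi_le_norm)
  have "star b = b" using assms posi_sa[of "b - a"] posi_sa[of a] by simp
  then have "posi ((norm b *\<^sub>R 1 - b) + (b - a))"
    using assms by (intro posi_add posi_one_minus) auto
  then show "posi (norm b *\<^sub>R 1 - a)" by simp
qed (use assms in auto)

lemma posi_antisym:
  assumes "posi a" "posi (- a)"
  shows "a = 0"
  using posi_norm_mono[of a 0] assms by simp

text \<open>If \<open>\<parallel>t\<parallel> = 1\<close>, put \<open>x = t t\<^sup>*\<close> and \<open>c = -t\<^sup>* t\<close>. Then \<open>t (1 + c) = (1 - x) t\<close> has norm at most 1,
  whereas \<open>\<parallel>t (1 + c)\<parallel>\<^sup>2 = \<parallel>c + 2c\<^sup>2 + c\<^sup>3\<parallel> \<ge> 2\<close>.\<close>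

lemma eq_0_if_posi_neg_star_mult:
  fixes t :: "'a::ucstar"
  assumes "posi (t * star t)" "posi (- (star t * t))"
  shows "t = 0"
proof (rule ccontr)
  assume "t \<noteq> 0"
  define s where "s = (1/norm t) *\<^sub>R t"
  define x where "x = s * star s"
  define c where "c = - (star s * s)"
  have s: "norm s = 1" using \<open>t \<noteq> 0\<close> by (simp add: s_def)
  have x: "posi x" using posi_scaleR[OF assms(1), of "1/norm t * (1/norm t)"] by (simp add: x_def s_def)
  have c: "posi c" using posi_scaleR[OF assms(2), of "1/norm t * (1/norm t)"] by (simp add: c_def s_def)
  have "posi (1 *\<^sub>R 1 - x)" using norm_mult_star[of s] s x by (intro posi_one_minus) (auto simp: x_def)
  moreover have "posi (1 *\<^sub>R 1 - (1 *\<^sub>R 1 - x))" using x by simp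
  ultimately have "norm (1 *\<^sub>R 1 - x) \<le> 1" by (rule posi_le_norm) auto
  then have "norm ((1 - x) * s) \<le> 1"
    using norm_mult_ineq[of "1 - x" s] s by simp
  moreover have "(1 - x) * s = s * (1 + c)" by (simp add: x_def c_def algebra_simps)
  ultimately have 1: "norm (s * (1 + c)) \<le> 1" by simp
  have "star (s * (1 + c)) * (s * (1 + c)) = (1 + c) * (star s * s) * (1 + c)"
    using c by (simp add: posi_sa mult.assoc)
  also have "star s * s = - c" by (simp add: c_def)
  finally have "(norm (s * (1 + c)))\<^sup>2 = norm ((1 + c) * c * (1 + c))"
    using norm_star_mult[of "s * (1 + c)"] by simp
  with 1 have "norm ((1 + c) * c * (1 + c)) \<le> 1" by (metis norm_ge_zero power_le_one)
  moreover have "norm (2 *\<^sub>R (c * c)) \<le> norm ((1 + c) * c * (1 + c))"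
  proof (rule posi_norm_mono)
    show "posi (2 *\<^sub>R (c * c))" using c by (intro posi_scaleR posi_square) (auto simp: posi_sa)
    have "posi (c + c * (c * c))"
      using c by (intro posi_add posi_mult posi_square) (auto simp: posi_sa mult.assoc)
    then show "posi ((1 + c) * c * (1 + c) - 2 *\<^sub>R (c * c))"
      by (simp add: algebra_simps scaleR_2)
  qed
  moreover have "norm (c * c) = 1"
    using norm_square_sa[of c] c norm_star_mult[of s] s by (simp add: posi_sa c_def)
  ultimately show False by simp
qed

text \<open>\<open>n\<close> is the root of \<open>a * a\<close> from \<open>posi_sqrt\<close>; it
  commutes with \<open>a\<close> because \<open>a\<close> commutes with
  \<open>a * a\<close>.\<close>

lemma abs_value:
  fixes a :: "'a::ucstar"
  assumes "star a = a"
  obtains n where "posi n" "n * n = a * a" "a * n = n * a"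
  using posi_sqrt[OF posi_square[OF assms]] by (metis mult.assoc)

text \<open>Let \<open>a = s\<^sup>* s\<close>, \<open>n = \<bar>a\<bar>\<close> and \<open>d = n - a\<close>, twice the negative part of \<open>a\<close>. For \<open>t = s d\<close> we get
  \<open>t\<^sup>* t = -n d\<^sup>2 \<le> 0\<close>, and then \<open>t t\<^sup>* \<ge> 0\<close> because \<open>t\<^sup>* t + t t\<^sup>*\<close> is twice the sum of the squares of
  the real and the imaginary part of \<open>t\<close>.\<close>

theorem posi_star_mult:
  fixes s :: "'a::ucstar"
  shows "posi (star s * s)"
proof -
  define a where "a = star s * s"
  have sa: "star a = a" by (simp add: a_def)
  obtain n where n: "posi n" "n * n = a * a" "a * n = n * a"
    using abs_value[OF sa] by blast
  define d where "d = n - a"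
  have d: "star d = d" "n * d = d * n" using n sa by (auto simp: d_def posi_sa algebra_simps)
  have ad: "a * d = - (n * d)" using n by (simp add: d_def algebra_simps)
  define t where "t = s * d"
  have tt: "star t * t = d * a * d" using d by (simp add: t_def a_def mult.assoc)
  also have "\<dots> = - (n * (d * d))" using ad d by (simp add: mult.assoc) (metis mult.assoc)
  finally have t1: "star t * t = - (n * (d * d))" .
  have nd: "posi (n * (d * d))"
    using n(1) d by (intro posi_mult posi_square) (simp_all add: mult.assoc[symmetric], simp add: mult.assoc)
  define h k where "h = t + star t" and "k = iu * (t - star t)"
  have h: "star h = h" by (simp add: h_def)
  have "star k = - ((star t - t) * iu)" by (simp add: k_def)
  then have k: "star k = k" by (simp add: k_def iu_commute algebra_simps)
  have "k * k = (iu * iu) * ((t - star t) * (t - star t))"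
    unfolding k_def by (metis iu_commute mult.assoc)
  then have k2: "k * k = - ((t - star t) * (t - star t))" by (simp add: iu_iu)
  have "t * star t = (1/2) *\<^sub>R (h * h + k * k) + n * (d * d)"
  proof -
    have "h * h + k * k = 2 *\<^sub>R (star t * t + t * star t)"
      unfolding k2 h_def by (simp add: algebra_simps scaleR_2)
    then show ?thesis using t1 by simp
  qed
  moreover have "posi ((1/2) *\<^sub>R (h * h + k * k) + n * (d * d))"
    using h k by (intro posi_add posi_scaleR posi_square nd) auto
  ultimately have "t = 0"
    using eq_0_if_posi_neg_star_mult[of t] nd t1 by simp
  then have z: "n * (d * d) = 0" using t1 by simp
  \<comment> \<open>Both \<open>n\<close> and \<open>a\<close> annihilate \<open>d^2\<close>, hence
    \<open>d^3 = (n - a) d^2 = 0\<close>. A self-adjoint nilpotent element vanishes by the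
    C*-identity, so \<open>a = n\<close>.\<close>
  have "a * (d * d) = - (n * (d * d))" by (metis ad mult.assoc mult_minus_left)
  then have "d * (d * d) = 0" using z by (simp add: d_def left_diff_distrib)
  then have "(d * d) * (d * d) = 0" by (simp add: mult.assoc)
  then have "d * d = 0" using mult_star_eq_0[of "d * d"] d by simp
  then have "d = 0" using mult_star_eq_0[of d] d by simp
  then show ?thesis using n by (simp add: d_def a_def)
qed

subsection \<open>Projections\<close>

lemma norm_projection_le:
  fixes p :: "'a::ucstar"
  assumes "star p = p" "p * p = p"
  shows "norm p \<le> 1"
proof -
  have "norm p = (norm p)\<^sup>2" using norm_square_sa[OF assms(1)] assms(2) by simp
  then show ?thesis by (metis order_refl mult_cancel_left2 power2_eq_square zero_le_one)
qed

lemma posi_conj: "posi a \<Longrightarrow> posi (star s * a * s)"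
proof -
  assume "posi a"
  then obtain w where w: "posi w" "w * w = a" using posi_sqrt by metis
  have "star s * a * s = star (w * s) * (w * s)"
    by (simp add: posi_sa[OF w(1)] mult.assoc flip: w(2))
  then show ?thesis by (simp only: posi_star_mult)
qed

text \<open>Compressing \<open>u - g\<close> by \<open>p\<close> gives \<open>0 <= p - g\<close>,
  and \<open>p - g <= p\<close> because \<open>g\<close> is positive. In the application
  \<open>u\<close> is the image of the unit of \<open>A\<close> in a larger algebra, whence it is
  kept apart from 1.\<close>

lemma norm_projection_minus_le:
  fixes p :: "'a::ucstar"
  assumes p: "star p = p" "p * p = p" and u: "u * p = p"
    and g: "posi g" "posi (u - g)" "p * g = g" "g * p = g"
  shows "norm (p - g) \<le> 1"
proof -
  have "posi (star p * (u - g) * p)" by (rule posi_conj[OF g(2)])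
  also have "star p * (u - g) * p = p - g" using p u g by (simp add: algebra_simps)
  finally have "norm (p - g) \<le> norm p" using g(1) by (intro posi_norm_mono) auto
  then show ?thesis using norm_projection_le[OF p] by simp
qed

text \<open>The map sending \<open>x\<close> to \<open>1 + e x\<close> is a contraction, and its
  fixed point is the right inverse. This replaces the Neumann series.\<close>

lemma right_inverse_one_minus:
  fixes e :: "'a::ucstar"
  assumes "norm e < 1"
  obtains r where "(1 - e) * r = 1"
proof -
  have "\<exists>!x. 1 + e * x = x"
  proof (rule banach_fix_type[of "norm e"])
    show "\<forall>x y. dist (1 + e * x) (1 + e * y) \<le> norm e * dist x y"
      by (auto simp: dist_norm norm_mult_ineq simp flip: right_diff_distrib)
  qed (use assms in auto)
  then show ?thesis using that by (metis add_diff_cancel_right' left_diff_distrib mult_1_left)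
qed

text \<open>For \<open>z = y c q\<close> the hypothesis makes \<open>z\<^sup>* z\<close> invertible in the corner of \<open>q\<close>, with inverse \<open>R\<close> say,
  and \<open>p = z R z\<^sup>*\<close>.\<close>

lemma projection_below_square:
  fixes y c q :: "'a::ucstar"
  assumes y: "star y = y" and c: "star c = c" and q: "star q = q" "q * q = q" "q \<noteq> 0"
    and b: "0 < \<beta>" and small: "norm (\<beta> *\<^sub>R q - q * c * y * y * c * q) < \<beta>"
  obtains p m s t where "star p = p" "p * p = p" "p \<noteq> 0" "p = y * m * y"
    "t *\<^sub>R (y * y) - p = star (s * y) * (s * y)"
proof -
  \<comment> \<open>Here \<open>e = q - star z * z / \<beta>\<close>, so that
    \<open>star z * z = \<beta> (1 - e) q\<close>. The inverse \<open>r\<close> of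
    \<open>1 - e\<close> in the whole algebra will commute with \<open>q\<close>, and the inverse in
    the corner is \<open>R = r q / \<beta>\<close>.\<close>
  define e where "e = q - (1/\<beta>) *\<^sub>R (q * c * y * y * c * q)"
  have "e = (1/\<beta>) *\<^sub>R (\<beta> *\<^sub>R q - q * c * y * y * c * q)"
    using b by (simp add: e_def algebra_simps)
  then have "norm e < 1" using small b by (simp add: divide_simps)
  then obtain r where r: "(1 - e) * r = 1" by (rule right_inverse_one_minus)
  have se: "star e = e" using y c q by (simp add: e_def mult.assoc)
  have r': "star r * (1 - e) = 1" using arg_cong[OF r, of star] se by simp
  have sr: "star r = r" by (metis r r' mult.assoc mult_1_left mult_1_right)
  have eq: "e * q = e" "q * e = e"
    using q(2) by (simp_all add: e_def algebra_simps) (simp add: mult.assoc[symmetric])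
  have comm: "(1 - e) * q = q * (1 - e)" by (simp add: algebra_simps eq)
  have rq: "r * q = q * r"
  proof -
    have "r * q = r * q * ((1 - e) * r)" by (simp add: r)
    also have "\<dots> = r * (q * (1 - e)) * r" by (simp add: mult.assoc)
    also have "\<dots> = star r * (1 - e) * q * r" by (simp add: sr flip: comm mult.assoc)
    finally show ?thesis by (simp add: r')
  qed
  define z where "z = y * c * q"
  have zz: "star z * z = \<beta> *\<^sub>R ((1 - e) * q)"
    using b y c q(1,2) eq(1) by (simp add: z_def e_def algebra_simps)
  have zq: "z * q = z" by (simp add: z_def q mult.assoc)
  define w where "w = (1/\<beta>) *\<^sub>R (r * star z)"
  define p where "p = z * w"
  define m where "m = (1/\<beta>) *\<^sub>R (c * q * r * q * c)"
  have sp: "star p = p" by (simp add: p_def w_def sr mult.assoc)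
  have pz: "p * z = z"
  proof -
    have "p * z = (1/\<beta>) *\<^sub>R (z * r * (star z * z))" by (simp add: p_def w_def mult.assoc)
    also have "\<dots> = z * (r * (1 - e)) * q" using b by (simp add: zz mult.assoc)
    also have "\<dots> = z" using r' by (simp add: sr zq)
    finally show ?thesis .
  qed
  have pp: "p * p = p"
  proof -
    have "p * p = p * z * w" by (metis p_def mult.assoc)
    then show ?thesis by (simp add: pz flip: p_def)
  qed
  have p0: "p \<noteq> 0"
  proof
    assume "p = 0"
    then have "z = 0" using pz by simp
    then have "(1 - e) * q = 0" using zz b by simp
    then have "star r * (1 - e) * q = 0" by (simp add: mult.assoc)
    then show False using r' q(3) by simp
  qed
  have pm: "p = y * m * y"
    using y c q(1) by (simp add: p_def w_def m_def z_def mult.assoc)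
  have sm: "star m = m" using c q(1) by (simp add: m_def sr mult.assoc)
  \<comment> \<open>A root of \<open>norm m - m\<close> writes \<open>norm m * y^2 - y m y\<close>
    as an explicit \<open>star (s y) * (s y)\<close>, the form that \<open>positive\<close> demands
    in the carrier algebra.\<close>
  have "posi (norm m *\<^sub>R 1 - m)" using posi_one_minus[OF sm] by simp
  then obtain s where s: "posi s" "s * s = norm m *\<^sub>R 1 - m" using posi_sqrt by metis
  have "star (s * y) * (s * y) = y * (s * s) * y"
    using y by (simp add: posi_sa[OF s(1)] mult.assoc)
  also have "\<dots> = norm m *\<^sub>R (y * y) - p" unfolding s(2) pm by (simp add: algebra_simps)
  finally show ?thesis using that[OF sp pp p0 pm, of "norm m" s] by simp
qed

text \<open>With \<open>\<beta> = \<parallel>b\<parallel>\<close> and \<open>e = b - (\<beta>/2) u\<close>, take \<open>d\<close> and \<open>h\<close> to be twice the negative and the positive part of \<open>e\<close>.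
  A projection annihilating \<open>d\<close> lies in the spectral subspace of \<open>b\<close> for \<open>[\<beta>/2, \<beta>]\<close>.\<close>

lemma spectral_cut:
  fixes b0 u :: "'a::ucstar"
  assumes u: "star u = u" "u * u = u" and b0: "b0 * u = b0" "b0 \<noteq> 0"
    and b: "b = star b0 * b0"
  obtains d h where "star d = d" "star h = h" "d * h = 0" "h \<noteq> 0" "d * u = d" "h * u = h"
    "\<And>q. star q = q \<Longrightarrow> q * q = q \<Longrightarrow> q * u = q \<Longrightarrow> q * d = 0
      \<Longrightarrow> norm (norm b *\<^sub>R q - q * b * q) \<le> norm b / 2"
proof -
  define \<beta> where "\<beta> = norm b"
  have pb: "posi b" unfolding b by (rule posi_star_mult)
  have sb: "star b = b" by (rule posi_sa[OF pb])
  have \<beta>: "\<beta> > 0" using b0(2) norm_star_mult[of b0] by (simp add: \<beta>_def b)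
  have bu: "b * u = b" using b0(1) by (simp add: b mult.assoc)
  have ub: "u * b = b" using arg_cong[OF bu, of star] sb u(1) by simp
  define e where "e = b - (\<beta>/2) *\<^sub>R u"
  have se: "star e = e" using sb u by (simp add: e_def)
  have eu: "e * u = e" "u * e = e" using bu ub u by (simp_all add: e_def algebra_simps)
  obtain n where n: "posi n" "n * n = e * e" "e * n = n * e" using abs_value[OF se] by blast
  have sn: "star n = n" by (rule posi_sa[OF n(1)])
  \<comment> \<open>\<open>n\<close> is known only through \<open>n^2 = e^2\<close>. Since
    \<open>e^2 u = e^2\<close>, the element \<open>n - n u\<close> is annihilated by
    \<open>n\<close>, and the C*-identity makes it vanish.\<close>
  have nu: "n * u = n"
  proof -
    have "n * (n - n * u) = 0" using eu by (simp add: right_diff_distrib n(2) flip: mult.assoc) (simp add: mult.assoc)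
    then have "star (n - n * u) * (n - n * u) = 0"
      using sn u by (simp add: left_diff_distrib) (simp add: mult.assoc)
    then show ?thesis using mult_star_eq_0 by fastforce
  qed
  have norm_u: "norm u \<le> 1" by (rule norm_projection_le[OF u])
  \<comment> \<open>Otherwise \<open>b <= (\<beta>/2) u\<close>, which contradicts
    \<open>norm b = \<beta>\<close>.\<close>
  have "n + e \<noteq> 0"
  proof
    assume "n + e = 0"
    then have "n = - e" by (simp add: add_eq_0_iff2)
    then have "posi ((\<beta>/2) *\<^sub>R u - b)" using n(1) by (simp add: e_def)
    then have "\<beta> \<le> norm ((\<beta>/2) *\<^sub>R u)" unfolding \<beta>_def by (rule posi_norm_mono[OF pb])
    also have "\<dots> \<le> \<beta>/2" using norm_u \<beta> by simp
    finally show False using \<beta> by simp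
  qed
  \<comment> \<open>On such a \<open>q\<close> the elements \<open>n\<close> and \<open>e\<close>
    agree, so \<open>q b q - (\<beta>/2) q = q n q\<close> is positive. Together with
    \<open>b <= \<beta>\<close> this places \<open>\<beta> q - q b q\<close> between 0 and
    \<open>(\<beta>/2) q\<close>.\<close>
  moreover have "norm (\<beta> *\<^sub>R q - q * b * q) \<le> \<beta> / 2"
    if q: "star q = q" "q * q = q" "q * u = q" "q * (n - e) = 0" for q
  proof -
    have ne: "q * n = q * e" using q(4) by (simp add: right_diff_distrib)
    have "q * n * q = q * b * q - (\<beta>/2) *\<^sub>R q"
      unfolding ne using q by (simp add: e_def algebra_simps)
    moreover have "posi (q * n * q)" using posi_conj[OF n(1), of q] q by simp
    moreover have "(\<beta>/2) *\<^sub>R q - (\<beta> *\<^sub>R q - q * b * q) = q * b * q - (\<beta>/2) *\<^sub>R q"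
      using scaleR_add_left[of "\<beta>/2" "\<beta>/2" q] by (simp add: algebra_simps)
    ultimately have 1: "posi ((\<beta>/2) *\<^sub>R q - (\<beta> *\<^sub>R q - q * b * q))"
      by metis
    have "posi (\<beta> *\<^sub>R 1 - b)" unfolding \<beta>_def by (rule posi_one_minus[OF sb]) simp
    from posi_conj[OF this, of q] have 2: "posi (\<beta> *\<^sub>R q - q * b * q)"
      using q by (simp add: algebra_simps)
    have "norm (\<beta> *\<^sub>R q - q * b * q) \<le> norm ((\<beta>/2) *\<^sub>R q)"
      by (rule posi_norm_mono[OF 2 1])
    also have "\<dots> \<le> \<beta>/2" using norm_projection_le[OF q(1,2)] \<beta> by simp
    finally show ?thesis .
  qed
  ultimately show ?thesis
    using sn se nu eu n(2,3) by (intro that[of "n - e" "n + e"]) (auto simp: \<beta>_def algebra_simps)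
qed

text \<open>The numerical margin behind the tolerance 1/10: \<open>norm b\<close> lies in
  \<open>[8/10, 11/10]\<close>, so the difference is at most \<open>11/100 + 1/10 = 0.21\<close>,
  while half of \<open>(norm b)^2\<close> is at least 0.32. It is applied to \<open>k = y c\<close>
  and the approximant of \<open>k\<close> in \<open>B\<close>.\<close>

lemma star_mult_close:
  fixes k b :: "'a::ucstar"
  assumes k: "norm k \<le> 1" "9/10 \<le> (norm k)\<^sup>2" and kb: "norm (k - b) < 1/10"
  shows "norm (star b * b - star k * k) < norm (star b * b) / 2"
proof -
  have "star b * b - star k * k = star (b - k) * b + star k * (b - k)"
    by (simp add: algebra_simps)
  moreover have "norm (star (b - k) * b) \<le> norm (k - b) * norm b"
    "norm (star k * (b - k)) \<le> norm k * norm (k - b)"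
    by (metis norm_minus_commute norm_mult_ineq norm_star)+
  ultimately have 1: "norm (star b * b - star k * k) \<le> norm (k - b) * norm b + norm k * norm (k - b)"
    by (metis add_mono norm_triangle_le)
  have "norm k \<ge> 9/10"
  proof (rule ccontr)
    assume "\<not> 9/10 \<le> norm k"
    then have "(norm k)\<^sup>2 < (9/10)\<^sup>2" by (intro power_strict_mono) auto
    then show False using k(2) by (simp add: power2_eq_square)
  qed
  then have b: "norm b \<ge> 8/10" "norm b \<le> 11/10"
    using norm_triangle_ineq2[of k b] norm_triangle_ineq2[of b k] k kb
    by (auto simp: norm_minus_commute)
  have "norm (k - b) * norm b + norm k * norm (k - b) \<le> 1/10 * (11/10) + 1 * (1/10)"
    using b k kb by (intro add_mono mult_mono) auto
  also have "\<dots> < (8/10) * (8/10) / 2" by simp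
  also have "\<dots> \<le> norm b * norm b / 2" using b by (intro divide_right_mono mult_mono) auto
  also have "\<dots> = norm (star b * b) / 2" by (simp add: norm_star_mult power2_eq_square)
  finally show ?thesis using 1 by linarith
qed

text \<open>From \<open>0 <= d x d <= d y d = 0\<close> one gets \<open>d x d = 0\<close>, and this
  is \<open>star (w d) * (w d)\<close> for the root \<open>w\<close> of \<open>x\<close>.\<close>

lemma annihilator_order:
  fixes d :: "'a::ucstar"
  assumes d: "star d = d" "y * d = 0" and x: "posi x" and yx: "posi (y - x)"
  shows "x * d = 0"
proof -
  obtain w where w: "posi w" "w * w = x" using posi_sqrt[OF x] by metis
  have "posi (star d * (y - x) * d)" by (rule posi_conj[OF yx])
  then have "posi (- (d * x * d))" using d by (simp add: algebra_simps)
  moreover have "posi (d * x * d)" using posi_conj[OF x, of d] d by simp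
  ultimately have "d * x * d = 0" by (intro posi_antisym)
  then have "star (w * d) * (w * d) = 0"
    using d by (simp add: posi_sa[OF w(1)] mult.assoc flip: w(2))
  then have "w * d = 0" by (rule mult_star_eq_0)
  then show ?thesis by (simp add: mult.assoc flip: w(2))
qed

section \<open>C*-algebras with a carrier\<close>

lemma complex_ring_simps [simp]:
  "carrier complex_ring = UNIV" "mult complex_ring = (*)" "one complex_ring = 1"
  "zero complex_ring = 0" "add complex_ring = (+)"
  by (simp_all add: complex_ring_def)

context cstar_algebra
begin

lemma smult_carrier [simp]: "x \<in> carrier A \<Longrightarrow> c \<odot> x \<in> carrier A"
  using smult_closed[of c x] by simp

lemma smult_add_left: "x \<in> carrier A \<Longrightarrow> (b + c) \<odot> x = b \<odot> x \<oplus> c \<odot> x"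
  using smult_l_distr[of b c x] by simp

lemma smult_add_right: "\<lbrakk>x \<in> carrier A; y \<in> carrier A\<rbrakk> \<Longrightarrow> c \<odot> (x \<oplus> y) = c \<odot> x \<oplus> c \<odot> y"
  using smult_r_distr[of c x y] by simp

lemma smult_smult: "x \<in> carrier A \<Longrightarrow> b \<odot> (c \<odot> x) = (b * c) \<odot> x"
  using smult_assoc1[of b c x] by simp

lemma one_smult [simp]: "x \<in> carrier A \<Longrightarrow> 1 \<odot> x = x"
  using smult_one[of x] by simp

lemma zero_smult [simp]: "x \<in> carrier A \<Longrightarrow> 0 \<odot> x = \<zero>"
  using smult_l_null[of x] by simp

lemma smult_zero [simp]: "c \<odot> \<zero> = \<zero>"
  using smult_r_null[of c] by simp

lemmas carrier_closed [simp] = mult_closed adj_closed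

lemma a_inv_eq_smult: "x \<in> carrier A \<Longrightarrow> \<ominus> x = (- 1) \<odot> x"
  using smult_add_left[of x 1 "- 1"] by (intro M.minus_equality) (auto simp: M.a_comm)

lemma a_minus_eq_smult: "\<lbrakk>x \<in> carrier A; y \<in> carrier A\<rbrakk> \<Longrightarrow> x \<ominus> y = x \<oplus> (- 1) \<odot> y"
  by (simp add: a_minus_def a_inv_eq_smult)

lemma a_minus_eq_zero_iff: "\<lbrakk>x \<in> carrier A; y \<in> carrier A\<rbrakk> \<Longrightarrow> x \<ominus> y = \<zero> \<longleftrightarrow> x = y"
  using M.minus_equality[of x "\<ominus> y"] by (auto simp: a_minus_def M.r_neg)

lemma nrm_zero [simp]: "nrm A \<zero> = 0"
  by (simp add: nrm_eq_0_iff)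

lemma nrm_minus_commute: "\<lbrakk>x \<in> carrier A; y \<in> carrier A\<rbrakk> \<Longrightarrow> nrm A (x \<ominus> y) = nrm A (y \<ominus> x)"
proof -
  assume xy: "x \<in> carrier A" "y \<in> carrier A"
  then have "x \<ominus> y = (- 1) \<odot> (y \<ominus> x)"
    by (simp add: a_minus_eq_smult smult_add_right smult_smult M.a_comm)
  then show ?thesis using nrm_smult[of "y \<ominus> x" "- 1"] xy by simp
qed

lemma nrm_minus_triangle:
  assumes "x \<in> carrier A" "y \<in> carrier A" "z \<in> carrier A"
  shows "nrm A (x \<ominus> z) \<le> nrm A (x \<ominus> y) + nrm A (y \<ominus> z)"
proof -
  have "x \<ominus> z = (x \<ominus> y) \<oplus> (y \<ominus> z)"
    using assms by (simp add: a_minus_def M.a_assoc M.r_neg1)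
  then show ?thesis using nrm_triangle[of "x \<ominus> y" "y \<ominus> z"] assms by simp
qed

lemma Metric_space: "Metric_space (carrier A) (ndist A)"
proof
  show "0 \<le> ndist A x y" for x y by (simp add: ndist_def nrm_nonneg)
  show "ndist A x y = ndist A y x" for x y by (simp add: ndist_def nrm_minus_commute)
  show "ndist A x y = 0 \<longleftrightarrow> x = y" if "x \<in> carrier A" "y \<in> carrier A" for x y
    using that by (simp add: ndist_def nrm_eq_0_iff a_minus_eq_zero_iff)
  show "ndist A x z \<le> ndist A x y + ndist A y z"
    if "x \<in> carrier A" "y \<in> carrier A" "z \<in> carrier A" for x y z
    using that by (simp add: ndist_def nrm_minus_triangle)
qed

lemma Cauchy_limit:
  assumes s: "\<And>n::nat. s n \<in> carrier A"
    and c: "\<And>e. e > 0 \<Longrightarrow> \<exists>N. \<forall>m\<ge>N. \<forall>n\<ge>N. nrm A (s m \<ominus> s n) < e"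
  shows "\<exists>l\<in>carrier A. \<forall>e>0. \<exists>N. \<forall>n\<ge>N. nrm A (s n \<ominus> l) < e"
proof -
  interpret M: Metric_space "carrier A" "ndist A" by (rule Metric_space)
  have "M.MCauchy s"
    unfolding M.MCauchy_def using s c by (auto simp: ndist_def)
  then obtain l where "limitin M.mtopology s l sequentially"
    using complete M.mcomplete_def by blast
  then show ?thesis
    unfolding M.limit_metric_sequentially using s by (auto simp: ndist_def intro!: bexI[of _ l])
qed

lemma adj_zero [simp]: "adj A \<zero> = \<zero>"
  using adj_smult[of \<zero> 0] by simp

lemma mult_zero [simp]: "x \<in> carrier A \<Longrightarrow> x \<otimes> \<zero> = \<zero>" "x \<in> carrier A \<Longrightarrow> \<zero> \<otimes> x = \<zero>"
  using smult_mult_right[of x \<zero> 0] smult_mult_left[of \<zero> x 0] by simp_all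

lemma nrm_adj: "x \<in> carrier A \<Longrightarrow> nrm A (adj A x) = nrm A x"
proof -
  have le: "nrm A y \<le> nrm A (adj A y)" if y: "y \<in> carrier A" for y
  proof (cases "nrm A y = 0")
    case False
    have "nrm A y * nrm A y \<le> nrm A (adj A y) * nrm A y"
      using nrm_mult[of "adj A y" y] nrm_cstar[of y] y by (simp add: power2_eq_square)
    then show ?thesis using False nrm_nonneg[OF y] by simp
  qed (simp add: nrm_nonneg y)
  assume "x \<in> carrier A"
  with le[of x] le[of "adj A x"] show ?thesis by (simp add: adj_adj)
qed

end

subsection \<open>The product of all unital C*-algebras on a type\<close>

text \<open>The bounded families indexed by all unital C*-algebras on \<^typ>\<open>'a\<close> form a type of
  class \<^class>\<open>ucstar\<close> in which each of these algebras embeds isometrically. This makes the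
  results for the type class available for algebras that are given by a carrier set.\<close>

typedef 'a cprod = "{f. f \<in> (\<Pi>\<^sub>E A\<in>{A :: 'a cstar. unital_cstar_algebra A}. carrier A) \<and>
    (\<exists>c. \<forall>A. unital_cstar_algebra A \<longrightarrow> nrm A (f A) \<le> c)}"
  morphisms coord Abs_cprod
proof -
  have "restrict (\<lambda>A. \<zero>\<^bsub>A\<^esub>) {A :: 'a cstar. unital_cstar_algebra A} \<in>
    {f. f \<in> (\<Pi>\<^sub>E A\<in>{A :: 'a cstar. unital_cstar_algebra A}. carrier A) \<and>
    (\<exists>c. \<forall>A. unital_cstar_algebra A \<longrightarrow> nrm A (f A) \<le> c)}"
    by (auto intro!: exI[of _ 0]
        simp: unital_cstar_algebra_def cstar_algebra.nrm_zero ring.ring_simprules)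
  then show ?thesis by blast
qed

definition tuple :: "('a cstar \<Rightarrow> 'a) \<Rightarrow> 'a cprod" where
  "tuple f = Abs_cprod (restrict f {A. unital_cstar_algebra A})"

text \<open>The constant \<open>c\<close> has to bound all coordinates at once; this is why each
  operation below comes with an estimate that does not depend on the algebra.\<close>

lemma coord_tuple:
  assumes "\<And>B. unital_cstar_algebra B \<Longrightarrow> f B \<in> carrier B"
    and "\<And>B. unital_cstar_algebra B \<Longrightarrow> nrm B (f B) \<le> c"
    and "unital_cstar_algebra A"
  shows "coord (tuple f) A = f A"
  unfolding tuple_def using assms by (subst Abs_cprod_inverse) auto

lemma coord_closed [simp]: "unital_cstar_algebra A \<Longrightarrow> coord x A \<in> carrier A"
  using coord[of x] by auto

lemma bdd_above_coord: "bdd_above (insert 0 ((\<lambda>A. nrm A (coord x A)) ` {A. unital_cstar_algebra A}))"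
proof -
  obtain c where "\<And>A. unital_cstar_algebra A \<Longrightarrow> nrm A (coord x A) \<le> c"
    using coord[of x] by auto
  then show ?thesis by (intro bdd_aboveI[of _ "max 0 c"]) (auto simp: le_max_iff_disj)
qed

lemma cprod_eqI:
  assumes "\<And>A. unital_cstar_algebra A \<Longrightarrow> coord x A = coord y A"
  shows "x = y"
proof -
  have "coord x = coord y"
    using assms coord[of x] coord[of y] by (intro PiE_ext[of "coord x" _ carrier "coord y"]) auto
  then show ?thesis by (simp add: coord_inject)
qed

lemma unital_cstarD: "unital_cstar_algebra A \<Longrightarrow> cstar_algebra A"
  "unital_cstar_algebra A \<Longrightarrow> Ring.ring A" "unital_cstar_algebra A \<Longrightarrow> abelian_group A"
  by (auto simp: unital_cstar_algebra_def ring_def)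

instantiation cprod :: (type) "{real_normed_algebra, monoid_mult}"
begin

text \<open>Inserting 0 keeps the set non-empty and the norm non-negative without exhibiting an
  algebra on the type.\<close>

definition "norm x = Sup (insert 0 ((\<lambda>A. nrm A (coord x A)) ` {A. unital_cstar_algebra A}))"
definition "0 = tuple (\<lambda>A. \<zero>\<^bsub>A\<^esub>)"
definition "1 = tuple (\<lambda>A. \<one>\<^bsub>A\<^esub>)"
definition "x + y = tuple (\<lambda>A. coord x A \<oplus>\<^bsub>A\<^esub> coord y A)"
definition "x * y = tuple (\<lambda>A. coord x A \<otimes>\<^bsub>A\<^esub> coord y A)"
definition "r *\<^sub>R x = tuple (\<lambda>A. complex_of_real r \<odot>\<^bsub>A\<^esub> coord x A)"
definition "- (x :: 'a cprod) = (- 1) *\<^sub>R x"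
definition "x - (y :: 'a cprod) = x + (- y)"

definition "sgn x = inverse (norm x) *\<^sub>R (x :: 'a cprod)"
definition "dist x y = norm (x - y :: 'a cprod)"
definition "uniformity = (INF e\<in>{0 <..}. principal {(x :: 'a cprod, y). dist x y < e})"
definition "open (U :: 'a cprod set) \<longleftrightarrow> (\<forall>x\<in>U. \<forall>\<^sub>F (x', y) in uniformity. x' = x \<longrightarrow> y \<in> U)"

lemma nrm_coord_le: "unital_cstar_algebra A \<Longrightarrow> nrm A (coord x A) \<le> norm x"
  unfolding norm_cprod_def by (rule cSup_upper[OF _ bdd_above_coord]) auto

lemma norm_cprod_nonneg: "0 \<le> norm (x :: 'a cprod)"
  unfolding norm_cprod_def by (rule cSup_upper[OF _ bdd_above_coord]) auto

lemma norm_cprod_le: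
  "0 \<le> c \<Longrightarrow> (\<And>A. unital_cstar_algebra A \<Longrightarrow> nrm A (coord x A) \<le> c) \<Longrightarrow> norm (x :: 'a cprod) \<le> c"
  unfolding norm_cprod_def by (rule cSup_least) auto

lemma nrm_one_le: "unital_cstar_algebra A \<Longrightarrow> nrm A \<one>\<^bsub>A\<^esub> \<le> 1"
proof -
  assume A: "unital_cstar_algebra A"
  interpret unital_cstar_algebra A by (rule A)
  have "adj A \<one>\<^bsub>A\<^esub> = \<one>\<^bsub>A\<^esub>"
    using adj_mult[of "adj A \<one>\<^bsub>A\<^esub>" "\<one>\<^bsub>A\<^esub>"] by (simp add: adj_adj)
  then have "nrm A \<one>\<^bsub>A\<^esub> = (nrm A \<one>\<^bsub>A\<^esub>)\<^sup>2" using nrm_cstar[of "\<one>\<^bsub>A\<^esub>"] by simp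
  then show ?thesis by (metis order_refl mult_cancel_left2 power2_eq_square zero_le_one)
qed

context
  fixes A :: "'a cstar"
  assumes A: "unital_cstar_algebra A"
begin

interpretation unital_cstar_algebra A by (rule A)

lemma coord_zero [simp]: "coord 0 A = \<zero>\<^bsub>A\<^esub>"
  unfolding zero_cprod_def
  by (rule coord_tuple[where c=0])
     (auto simp: A unital_cstarD cstar_algebra.nrm_zero ring.ring_simprules)

lemma coord_one [simp]: "coord 1 A = \<one>\<^bsub>A\<^esub>"
  unfolding one_cprod_def
  by (rule coord_tuple[where c=1])
     (auto simp: A nrm_one_le unital_cstarD ring.ring_simprules)

lemma coord_add [simp]: "coord (x + y) A = coord x A \<oplus>\<^bsub>A\<^esub> coord y A"
  unfolding plus_cprod_def
proof (rule coord_tuple[where c="norm x + norm y"])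
  fix B :: "'a cstar" assume B: "unital_cstar_algebra B"
  then interpret B: unital_cstar_algebra B .
  show "coord x B \<oplus>\<^bsub>B\<^esub> coord y B \<in> carrier B" using B by simp
  show "nrm B (coord x B \<oplus>\<^bsub>B\<^esub> coord y B) \<le> norm x + norm y"
    using B.nrm_triangle[of "coord x B" "coord y B"] nrm_coord_le[OF B, of x]
      nrm_coord_le[OF B, of y] B by simp
qed (rule A)

lemma coord_mult [simp]: "coord (x * y) A = coord x A \<otimes>\<^bsub>A\<^esub> coord y A"
  unfolding times_cprod_def
proof (rule coord_tuple[where c="norm x * norm y"])
  fix B :: "'a cstar" assume B: "unital_cstar_algebra B"
  then interpret B: unital_cstar_algebra B .
  show "coord x B \<otimes>\<^bsub>B\<^esub> coord y B \<in> carrier B" using B by simp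
  have "nrm B (coord x B \<otimes>\<^bsub>B\<^esub> coord y B) \<le> nrm B (coord x B) * nrm B (coord y B)"
    using B.nrm_mult B by simp
  also have "\<dots> \<le> norm x * norm y"
    using B by (intro mult_mono nrm_coord_le B.nrm_nonneg norm_cprod_nonneg) auto
  finally show "nrm B (coord x B \<otimes>\<^bsub>B\<^esub> coord y B) \<le> norm x * norm y" .
qed (rule A)

lemma coord_scaleR [simp]: "coord (r *\<^sub>R x) A = complex_of_real r \<odot>\<^bsub>A\<^esub> coord x A"
  unfolding scaleR_cprod_def
proof (rule coord_tuple[where c="\<bar>r\<bar> * norm x"])
  fix B :: "'a cstar" assume B: "unital_cstar_algebra B"
  then interpret B: unital_cstar_algebra B .
  show "complex_of_real r \<odot>\<^bsub>B\<^esub> coord x B \<in> carrier B" using B by simp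
  show "nrm B (complex_of_real r \<odot>\<^bsub>B\<^esub> coord x B) \<le> \<bar>r\<bar> * norm x"
    using B nrm_coord_le[OF B] by (simp add: B.nrm_smult mult_left_mono)
qed (rule A)

lemma coord_uminus: "coord (- x) A = (- 1) \<odot>\<^bsub>A\<^esub> coord x A"
  by (simp add: uminus_cprod_def)

lemma coord_diff [simp]: "coord (x - y) A = coord x A \<ominus>\<^bsub>A\<^esub> coord y A"
  using A by (simp add: minus_cprod_def coord_uminus a_minus_eq_smult)

end

instance
proof
  fix x y z :: "'a cprod" and r s :: real
  show "x + y + z = x + (y + z)"
    by (rule cprod_eqI) (simp add: abelian_monoid.a_assoc abelian_group.axioms unital_cstarD)
  show "x + y = y + x"
    by (rule cprod_eqI) (simp add: abelian_monoid.a_comm abelian_group.axioms unital_cstarD)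
  show "0 + x = x"
    by (rule cprod_eqI) (simp add: abelian_monoid.l_zero abelian_group.axioms unital_cstarD)
  show "- x + x = 0"
  proof (rule cprod_eqI)
    fix A :: "'a cstar" assume A: "unital_cstar_algebra A"
    then interpret unital_cstar_algebra A .
    show "coord (- x + x) A = coord 0 A"
      using A a_inv_eq_smult[of "coord x A"] M.l_neg[of "coord x A"] by (simp add: coord_uminus)
  qed
  show "x - y = x + - y" by (fact minus_cprod_def)
  show "r *\<^sub>R (x + y) = r *\<^sub>R x + r *\<^sub>R y"
    by (rule cprod_eqI) (simp add: cstar_algebra.smult_add_right unital_cstarD)
  show "(r + s) *\<^sub>R x = r *\<^sub>R x + s *\<^sub>R x"
    by (rule cprod_eqI) (simp add: cstar_algebra.smult_add_left unital_cstarD)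
  show "r *\<^sub>R s *\<^sub>R x = (r * s) *\<^sub>R x"
    by (rule cprod_eqI) (simp add: cstar_algebra.smult_smult unital_cstarD)
  show "1 *\<^sub>R x = x"
    by (rule cprod_eqI) (simp add: cstar_algebra.one_smult unital_cstarD)
  show "x * y * z = x * (y * z)"
    by (rule cprod_eqI) (simp add: cstar_algebra.mult_assoc unital_cstarD)
  show "(x + y) * z = x * z + y * z"
    by (rule cprod_eqI) (simp add: cstar_algebra.distr_left unital_cstarD)
  show "x * (y + z) = x * y + x * z"
    by (rule cprod_eqI) (simp add: cstar_algebra.distr_right unital_cstarD)
  show "r *\<^sub>R x * y = r *\<^sub>R (x * y)"
    by (rule cprod_eqI) (simp add: cstar_algebra.smult_mult_left unital_cstarD)
  show "x * r *\<^sub>R y = r *\<^sub>R (x * y)"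
    by (rule cprod_eqI) (simp add: cstar_algebra.smult_mult_right unital_cstarD)
  show "1 * x = x"
    by (rule cprod_eqI) (simp add: ring.ring_simprules unital_cstarD)
  show "x * 1 = x"
    by (rule cprod_eqI) (simp add: monoid.r_one ring.is_monoid unital_cstarD)
  show "norm x = 0 \<longleftrightarrow> x = 0"
  proof
    assume x: "norm x = 0"
    show "x = 0"
    proof (rule cprod_eqI)
      fix A :: "'a cstar" assume A: "unital_cstar_algebra A"
      then interpret unital_cstar_algebra A .
      have "nrm A (coord x A) = 0"
        using nrm_coord_le[OF A, of x] nrm_nonneg[of "coord x A"] A x by simp
      then show "coord x A = coord 0 A" using A nrm_eq_0_iff by simp
    qed
  next
    assume "x = 0"
    then have "norm x \<le> 0"
      by (intro norm_cprod_le) (auto simp: cstar_algebra.nrm_zero unital_cstarD)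
    then show "norm x = 0" using norm_cprod_nonneg[of x] by simp
  qed
  show "norm (x + y) \<le> norm x + norm y"
  proof (rule norm_cprod_le)
    fix A :: "'a cstar" assume A: "unital_cstar_algebra A"
    then interpret unital_cstar_algebra A .
    show "nrm A (coord (x + y) A) \<le> norm x + norm y"
      using nrm_triangle[of "coord x A" "coord y A"] nrm_coord_le[OF A, of x]
        nrm_coord_le[OF A, of y] A by simp
  qed (simp add: norm_cprod_nonneg)
  \<comment> \<open>Used for \<open>r\<close> and again for \<open>inverse r\<close>, this
    inequality gives both directions of homogeneity.\<close>
  have scale_le: "norm (r *\<^sub>R x) \<le> \<bar>r\<bar> * norm x" for r and x :: "'a cprod"
  proof (rule norm_cprod_le)
    fix A :: "'a cstar" assume A: "unital_cstar_algebra A"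
    then interpret unital_cstar_algebra A .
    show "nrm A (coord (r *\<^sub>R x) A) \<le> \<bar>r\<bar> * norm x"
      using A nrm_coord_le[OF A] by (simp add: nrm_smult mult_left_mono)
  qed (simp add: norm_cprod_nonneg)
  show "norm (r *\<^sub>R x) = \<bar>r\<bar> * norm x"
  proof (rule antisym[OF scale_le])
    show "\<bar>r\<bar> * norm x \<le> norm (r *\<^sub>R x)"
    proof (cases "r = 0")
      case False
      have "inverse r *\<^sub>R r *\<^sub>R x = x"
        using False by (intro cprod_eqI)
          (simp add: cstar_algebra.smult_smult cstar_algebra.one_smult unital_cstarD)
      then have "norm x \<le> \<bar>inverse r\<bar> * norm (r *\<^sub>R x)"
        using scale_le[of "inverse r" "r *\<^sub>R x"] by simp
      then show ?thesis using False by (simp add: field_simps)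
    qed (simp add: norm_cprod_nonneg)
  qed
  show "norm (x * y) \<le> norm x * norm y"
  proof (rule norm_cprod_le)
    fix A :: "'a cstar" assume A: "unital_cstar_algebra A"
    then interpret unital_cstar_algebra A .
    have "nrm A (coord x A \<otimes>\<^bsub>A\<^esub> coord y A) \<le> nrm A (coord x A) * nrm A (coord y A)"
      using nrm_mult A by simp
    also have "\<dots> \<le> norm x * norm y"
      using A by (intro mult_mono nrm_coord_le nrm_nonneg norm_cprod_nonneg) auto
    finally show "nrm A (coord (x * y) A) \<le> norm x * norm y" using A by simp
  qed (simp add: norm_cprod_nonneg)
qed (fact sgn_cprod_def dist_cprod_def uniformity_cprod_def open_cprod_def)+

end

instantiation cprod :: (type) ucstar
begin

definition "star x = tuple (\<lambda>A. adj A (coord x A))"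
definition "iu = tuple (\<lambda>A. \<i> \<odot>\<^bsub>A\<^esub> \<one>\<^bsub>A\<^esub>)"

context
  fixes A :: "'a cstar"
  assumes A: "unital_cstar_algebra A"
begin

interpretation unital_cstar_algebra A by (rule A)

lemma coord_star [simp]: "coord (star x) A = adj A (coord x A)"
  unfolding star_cprod_def
proof (rule coord_tuple[where c="norm x"])
  fix B :: "'a cstar" assume B: "unital_cstar_algebra B"
  then interpret B: unital_cstar_algebra B .
  show "adj B (coord x B) \<in> carrier B" using B by simp
  show "nrm B (adj B (coord x B)) \<le> norm x"
    using B nrm_coord_le[OF B] by (simp add: B.nrm_adj)
qed (rule A)

lemma coord_iu [simp]: "coord iu A = \<i> \<odot>\<^bsub>A\<^esub> \<one>\<^bsub>A\<^esub>"
  unfolding iu_cprod_def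
proof (rule coord_tuple[where c=1])
  fix B :: "'a cstar" assume B: "unital_cstar_algebra B"
  then interpret B: unital_cstar_algebra B .
  show "\<i> \<odot>\<^bsub>B\<^esub> \<one>\<^bsub>B\<^esub> \<in> carrier B" by simp
  show "nrm B (\<i> \<odot>\<^bsub>B\<^esub> \<one>\<^bsub>B\<^esub>) \<le> 1" using nrm_one_le[OF B] by (simp add: B.nrm_smult)
qed (rule A)

lemma adj_one [simp]: "adj A \<one>\<^bsub>A\<^esub> = \<one>\<^bsub>A\<^esub>"
  using adj_mult[of "adj A \<one>\<^bsub>A\<^esub>" "\<one>\<^bsub>A\<^esub>"] by (simp add: adj_adj)

end

instance
proof
  fix X :: "nat \<Rightarrow> 'a cprod"
  assume X: "Cauchy X"
  then have X': "\<exists>N. \<forall>m\<ge>N. \<forall>n\<ge>N. norm (X m - X n) < e" if "e > 0" for e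
    using that unfolding Cauchy_def dist_norm by blast
  define lim where "lim A l \<longleftrightarrow> l \<in> carrier A \<and> (\<forall>e>0. \<exists>N. \<forall>n\<ge>N. nrm A (coord (X n) A \<ominus>\<^bsub>A\<^esub> l) < e)"
    for A :: "'a cstar" and l
  have ex: "\<exists>l. lim A l" if A: "unital_cstar_algebra A" for A
  proof -
    interpret unital_cstar_algebra A by (rule A)
    have "\<exists>N. \<forall>m\<ge>N. \<forall>n\<ge>N. nrm A (coord (X m) A \<ominus>\<^bsub>A\<^esub> coord (X n) A) < e" if "e > 0" for e
      using X'[OF that] nrm_coord_le[OF A] coord_diff[OF A] by (metis order_le_less_trans)
    then show ?thesis
      using Cauchy_limit[of "\<lambda>n. coord (X n) A"] A unfolding lim_def by auto
  qed
  define L where "L A = (SOME l. lim A l)" for A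
  have L: "lim A (L A)" if "unital_cstar_algebra A" for A
    unfolding L_def using ex[OF that] by (rule someI_ex)
  \<comment> \<open>The bound is uniform in the algebra. It shows that the coordinatewise limits
    form a bounded family and that the convergence holds in the supremum norm.\<close>
  have close: "nrm A (coord (X m) A \<ominus>\<^bsub>A\<^esub> L A) \<le> e"
    if A: "unital_cstar_algebra A" and N: "\<forall>m\<ge>N. \<forall>n\<ge>N. norm (X m - X n) < e" and m: "m \<ge> N" for A N e m
  proof (rule field_le_epsilon)
    interpret unital_cstar_algebra A by (rule A)
    fix d :: real
    assume "d > 0"
    then obtain K where K: "\<forall>n\<ge>K. nrm A (coord (X n) A \<ominus>\<^bsub>A\<^esub> L A) < d"
      using L[OF A] unfolding lim_def by blast
    define n where "n = max K N"
    have "nrm A (coord (X m - X n) A) < e"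
      using nrm_coord_le[OF A, of "X m - X n"] N m by (simp add: n_def order_le_less_trans del: coord_diff)
    moreover have "nrm A (coord (X n) A \<ominus>\<^bsub>A\<^esub> L A) < d" using K by (simp add: n_def)
    ultimately show "nrm A (coord (X m) A \<ominus>\<^bsub>A\<^esub> L A) \<le> e + d"
      using nrm_minus_triangle[of "coord (X m) A" "coord (X n) A" "L A"] L[OF A] A
      by (simp add: lim_def)
  qed
  obtain N where N: "\<forall>m\<ge>N. \<forall>n\<ge>N. norm (X m - X n) < 1" using X'[of 1] by auto
  have cL: "coord (tuple L) A = L A" if "unital_cstar_algebra A" for A
  proof (rule coord_tuple[where c="norm (X N) + 1"])
    fix B :: "'a cstar" assume B: "unital_cstar_algebra B"
    then interpret B: unital_cstar_algebra B .
    show LB: "L B \<in> carrier B" using L[OF B] by (simp add: lim_def)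
    have "nrm B (L B \<ominus>\<^bsub>B\<^esub> coord (X N) B) \<le> 1"
      using close[OF B N, of N] B LB by (simp add: B.nrm_minus_commute)
    then show "nrm B (L B) \<le> norm (X N) + 1"
      using B.nrm_minus_triangle[of "L B" "coord (X N) B" "\<zero>\<^bsub>B\<^esub>"] nrm_coord_le[OF B, of "X N"] LB B
      by (simp add: B.a_minus_eq_smult)
  qed (rule that)
  have "X \<longlonglongrightarrow> tuple L"
    unfolding lim_sequentially dist_norm
  proof (intro allI impI)
    fix e :: real
    assume "e > 0"
    then obtain N where N: "\<forall>m\<ge>N. \<forall>n\<ge>N. norm (X m - X n) < e/2" using X'[of "e/2"] by auto
    have "norm (X n - tuple L) \<le> e/2" if "n \<ge> N" for n
      using \<open>e > 0\<close> close[OF _ N that] by (intro norm_cprod_le) (auto simp: cL)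
    then show "\<exists>N. \<forall>n\<ge>N. norm (X n - tuple L) < e"
      using \<open>e > 0\<close> by (intro exI[of _ N]) (smt (verit) field_sum_of_halves)
  qed
  then show "convergent X" by (auto simp: convergent_def)
next
  fix x y z :: "'a cprod" and r s :: real
  show "star (star x) = x"
    by (rule cprod_eqI) (simp add: cstar_algebra.adj_adj unital_cstarD)
  show "star (x + y) = star x + star y"
    by (rule cprod_eqI) (simp add: cstar_algebra.adj_add unital_cstarD)
  show "star (r *\<^sub>R x) = r *\<^sub>R star x"
    by (rule cprod_eqI) (simp add: cstar_algebra.adj_smult unital_cstarD)
  show "star (x * y) = star y * star x"
    by (rule cprod_eqI) (simp add: cstar_algebra.adj_mult unital_cstarD)
  show "iu * x = x * iu"
  proof (rule cprod_eqI)
    fix A :: "'a cstar" assume A: "unital_cstar_algebra A"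
    then interpret unital_cstar_algebra A .
    show "coord (iu * x) A = coord (x * iu) A"
      using A by (simp add: smult_mult_left smult_mult_right)
  qed
  show "iu * iu = - (1 :: 'a cprod)"
  proof (rule cprod_eqI)
    fix A :: "'a cstar" assume A: "unital_cstar_algebra A"
    then interpret unital_cstar_algebra A .
    show "coord (iu * iu) A = coord (- 1) A"
      using A by (simp add: smult_mult_left smult_mult_right smult_smult coord_uminus)
  qed
  show "star iu = - (iu :: 'a cprod)"
  proof (rule cprod_eqI)
    fix A :: "'a cstar" assume A: "unital_cstar_algebra A"
    then interpret unital_cstar_algebra A .
    show "coord (star iu) A = coord (- iu) A"
      using A by (simp add: adj_smult smult_smult coord_uminus)
  qed
  show "norm (star x * x) = (norm x)\<^sup>2"
  proof (rule antisym)
    show "norm (star x * x) \<le> (norm x)\<^sup>2"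
    proof (rule norm_cprod_le)
      fix A :: "'a cstar" assume A: "unital_cstar_algebra A"
      then interpret unital_cstar_algebra A .
      show "nrm A (coord (star x * x) A) \<le> (norm x)\<^sup>2"
        using A nrm_cstar[of "coord x A"] by (simp add: nrm_coord_le power_mono nrm_nonneg)
    qed simp
    have "norm x \<le> sqrt (norm (star x * x))"
    proof (rule norm_cprod_le)
      fix A :: "'a cstar" assume A: "unital_cstar_algebra A"
      then interpret unital_cstar_algebra A .
      have "(nrm A (coord x A))\<^sup>2 \<le> norm (star x * x)"
        using A nrm_cstar[of "coord x A"] nrm_coord_le[OF A, of "star x * x"] by simp
      then show "nrm A (coord x A) \<le> sqrt (norm (star x * x))"
        using real_le_rsqrt by blast
    qed (simp add: norm_cprod_nonneg)
    then show "(norm x)\<^sup>2 \<le> norm (star x * x)"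
      using norm_cprod_nonneg by (metis power_mono real_sqrt_pow2)
  qed
qed

end

section \<open>Isometric embedding of a single algebra into the product\<close>

definition emb :: "'a cstar \<Rightarrow> 'a \<Rightarrow> 'a cprod" where
  "emb A x = tuple (\<lambda>B. if B = A then x else \<zero>\<^bsub>B\<^esub>)"

context
  fixes A :: "'a cstar"
  assumes A: "unital_cstar_algebra A"
begin

interpretation unital_cstar_algebra A by (rule A)

lemma coord_emb:
  assumes x: "x \<in> carrier A" and B: "unital_cstar_algebra B"
  shows "coord (emb A x) B = (if B = A then x else \<zero>\<^bsub>B\<^esub>)"
  unfolding emb_def
proof (rule coord_tuple[where c="nrm A x"])
  fix B :: "'a cstar" assume B: "unital_cstar_algebra B"
  then interpret B: unital_cstar_algebra B .
  show "(if B = A then x else \<zero>\<^bsub>B\<^esub>) \<in> carrier B" using x by simp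
  show "nrm B (if B = A then x else \<zero>\<^bsub>B\<^esub>) \<le> nrm A x" using nrm_nonneg[OF x] by simp
qed (rule B)

lemma coord_emb_self [simp]: "x \<in> carrier A \<Longrightarrow> coord (emb A x) A = x"
  by (simp add: coord_emb A)

lemma emb_zero [simp]: "emb A \<zero>\<^bsub>A\<^esub> = 0"
  by (rule cprod_eqI) (simp add: coord_emb)

lemma emb_add [simp]: "\<lbrakk>x \<in> carrier A; y \<in> carrier A\<rbrakk> \<Longrightarrow> emb A (x \<oplus>\<^bsub>A\<^esub> y) = emb A x + emb A y"
proof (rule cprod_eqI)
  fix B :: "'a cstar" assume xy: "x \<in> carrier A" "y \<in> carrier A" and B: "unital_cstar_algebra B"
  then interpret B: unital_cstar_algebra B by simp
  show "coord (emb A (x \<oplus>\<^bsub>A\<^esub> y)) B = coord (emb A x + emb A y) B"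
    using xy B by (simp add: coord_emb)
qed

lemma emb_mult [simp]: "\<lbrakk>x \<in> carrier A; y \<in> carrier A\<rbrakk> \<Longrightarrow> emb A (x \<otimes>\<^bsub>A\<^esub> y) = emb A x * emb A y"
proof (rule cprod_eqI)
  fix B :: "'a cstar" assume xy: "x \<in> carrier A" "y \<in> carrier A" and B: "unital_cstar_algebra B"
  then interpret B: unital_cstar_algebra B by simp
  show "coord (emb A (x \<otimes>\<^bsub>A\<^esub> y)) B = coord (emb A x * emb A y) B"
    using xy B by (simp add: coord_emb)
qed

lemma emb_scaleR [simp]: "x \<in> carrier A \<Longrightarrow> emb A (complex_of_real r \<odot>\<^bsub>A\<^esub> x) = r *\<^sub>R emb A x"
proof (rule cprod_eqI)
  fix B :: "'a cstar" assume x: "x \<in> carrier A" and B: "unital_cstar_algebra B"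
  then interpret B: unital_cstar_algebra B by simp
  show "coord (emb A (complex_of_real r \<odot>\<^bsub>A\<^esub> x)) B = coord (r *\<^sub>R emb A x) B"
    using x B by (simp add: coord_emb)
qed

lemma emb_adj [simp]: "x \<in> carrier A \<Longrightarrow> emb A (adj A x) = star (emb A x)"
proof (rule cprod_eqI)
  fix B :: "'a cstar" assume x: "x \<in> carrier A" and B: "unital_cstar_algebra B"
  then interpret B: unital_cstar_algebra B by simp
  show "coord (emb A (adj A x)) B = coord (star (emb A x)) B"
    using x B by (simp add: coord_emb)
qed

lemma emb_diff [simp]: "\<lbrakk>x \<in> carrier A; y \<in> carrier A\<rbrakk> \<Longrightarrow> emb A (x \<ominus>\<^bsub>A\<^esub> y) = emb A x - emb A y"
  using emb_scaleR[of y "- 1"] by (simp add: a_minus_eq_smult)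

lemma norm_emb [simp]: "x \<in> carrier A \<Longrightarrow> norm (emb A x) = nrm A x"
proof (rule antisym)
  assume x: "x \<in> carrier A"
  show "norm (emb A x) \<le> nrm A x"
    using x by (intro norm_cprod_le)
      (auto simp: nrm_nonneg coord_emb cstar_algebra.nrm_zero unital_cstarD)
  show "nrm A x \<le> norm (emb A x)" using nrm_coord_le[OF A, of "emb A x"] x by simp
qed

lemma emb_eq_0_iff [simp]: "x \<in> carrier A \<Longrightarrow> emb A x = 0 \<longleftrightarrow> x = \<zero>\<^bsub>A\<^esub>"
  by (metis norm_emb norm_eq_zero nrm_eq_0_iff)

lemma emb_one_mult [simp]:
  "x \<in> carrier A \<Longrightarrow> emb A \<one>\<^bsub>A\<^esub> * emb A x = emb A x"
  "x \<in> carrier A \<Longrightarrow> emb A x * emb A \<one>\<^bsub>A\<^esub> = emb A x"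
  by (simp_all flip: emb_mult)

lemma star_emb_one [simp]: "star (emb A \<one>\<^bsub>A\<^esub>) = emb A \<one>\<^bsub>A\<^esub>"
  by (simp flip: emb_adj add: adj_one[OF A])

text \<open>The image of the unit of \<open>A\<close> is 0 in all other coordinates, so an element
  that it fixes from the right is supported at \<open>A\<close>. This returns elements constructed
  in the product to \<open>A\<close>.\<close>

lemma emb_coord: "f * emb A \<one>\<^bsub>A\<^esub> = f \<Longrightarrow> emb A (coord f A) = f"
proof (rule cprod_eqI)
  fix B :: "'a cstar" assume f: "f * emb A \<one>\<^bsub>A\<^esub> = f" and B: "unital_cstar_algebra B"
  then interpret B: unital_cstar_algebra B by simp
  have "coord f B = coord f B \<otimes>\<^bsub>B\<^esub> coord (emb A \<one>\<^bsub>A\<^esub>) B"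
    using arg_cong[OF f, of "\<lambda>f. coord f B"] B by simp
  then show "coord (emb A (coord f A)) B = coord f B"
    using A B by (simp add: coord_emb split: if_splits)
qed

text \<open>The bridge from the algebraic order on the carrier to positivity in the norm; it rests
  on \<open>posi_star_mult\<close>.\<close>

lemma posi_emb_if_le:
  assumes "cstar_le A x y"
  shows "posi (emb A y - emb A x)"
proof -
  from assms obtain s where xy: "x \<in> carrier A" "y \<in> carrier A" "s \<in> carrier A"
      "y \<ominus>\<^bsub>A\<^esub> x = adj A s \<otimes>\<^bsub>A\<^esub> s"
    unfolding cstar_le_def positive_def by blast
  then have "emb A y - emb A x = star (emb A s) * emb A s" by (simp flip: emb_diff)
  then show ?thesis by (simp add: posi_star_mult)
qed

end

subsection \<open>Hereditary subalgebras\<close>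

text \<open>The algebraic laws and norm identities are inherited. Only completeness takes work: a
  Cauchy sequence in \<open>S\<close> converges in \<open>A\<close>, and \<open>lim\<close> puts the
  limit into \<open>S\<close>.\<close>

lemma (in cstar_algebra) cstar_algebra_restrict:
  assumes S: "S \<subseteq> carrier A" "\<zero> \<in> S"
    and closed: "\<And>x y. x \<in> S \<Longrightarrow> y \<in> S \<Longrightarrow> x \<oplus> y \<in> S" "\<And>x y. x \<in> S \<Longrightarrow> y \<in> S \<Longrightarrow> x \<otimes> y \<in> S"
      "\<And>c x. x \<in> S \<Longrightarrow> c \<odot> x \<in> S" "\<And>x. x \<in> S \<Longrightarrow> adj A x \<in> S"
    and lim: "\<And>s l. (\<And>n::nat. s n \<in> S) \<Longrightarrow> l \<in> carrier A
      \<Longrightarrow> (\<And>e. e > 0 \<Longrightarrow> \<exists>N. \<forall>n\<ge>N. nrm A (s n \<ominus> l) < e) \<Longrightarrow> l \<in> S"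
  shows "cstar_algebra (A\<lparr>carrier := S\<rparr>)"
proof -
  have inv: "\<ominus> x \<in> S" if "x \<in> S" for x
    using a_inv_eq_smult[of x] closed(3)[OF that] S that by auto
  have sub: "submodule S complex_ring A"
    by (rule submoduleI) (use S closed inv in auto)
  have mod: "Module.module complex_ring (A\<lparr>carrier := S\<rparr>)"
    by (rule submodule.submodule_is_module[OF sub module_axioms])
  interpret S: Module.module complex_ring "A\<lparr>carrier := S\<rparr>" by (rule mod)
  \<comment> \<open>The additive inverse is a description relative to the carrier, so its agreement
    in both records needs a proof; \<open>ndist\<close> depends on it.\<close>
  have ainv: "\<ominus>\<^bsub>A\<lparr>carrier := S\<rparr>\<^esub> x = \<ominus> x" if x: "x \<in> S" for x
    using S.M.minus_equality[of "\<ominus> x" x] x inv[OF x] S M.l_neg[of x] by auto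
  have dist: "ndist (A\<lparr>carrier := S\<rparr>) x y = ndist A x y" if "x \<in> S" "y \<in> S" for x y
    using that S ainv[of y] by (auto simp: ndist_def a_minus_def)
  interpret M: Metric_space "carrier A" "ndist A" by (rule Metric_space)
  interpret SM: Metric_space S "ndist (A\<lparr>carrier := S\<rparr>)"
  proof
    show "0 \<le> ndist (A\<lparr>carrier := S\<rparr>) x y" for x y
      using dist[of x y] M.nonneg[of x y] by (cases "x \<in> S \<and> y \<in> S") (auto simp: ndist_def)
    show "ndist (A\<lparr>carrier := S\<rparr>) x y = ndist (A\<lparr>carrier := S\<rparr>) y x" for x y
      using dist[of x y] dist[of y x] M.commute[of x y]
      by (cases "x \<in> S \<and> y \<in> S") (auto simp: ndist_def)
    show "ndist (A\<lparr>carrier := S\<rparr>) x y = 0 \<longleftrightarrow> x = y" if "x \<in> S" "y \<in> S" for x y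
      using that dist[of x y] S(1) M.zero[of x y] by (metis subsetD)
    show "ndist (A\<lparr>carrier := S\<rparr>) x z \<le> ndist (A\<lparr>carrier := S\<rparr>) x y + ndist (A\<lparr>carrier := S\<rparr>) y z"
      if "x \<in> S" "y \<in> S" "z \<in> S" for x y z
      using that dist M.triangle[of x y z] S by auto
  qed
  have "SM.mcomplete"
    unfolding SM.mcomplete_def
  proof (intro allI impI)
    fix s :: "nat \<Rightarrow> 'a"
    assume s: "SM.MCauchy s"
    then have sS: "s n \<in> S" for n unfolding SM.MCauchy_def by auto
    have "M.MCauchy s"
      using s sS S dist unfolding SM.MCauchy_def M.MCauchy_def by auto
    then obtain l where "limitin M.mtopology s l sequentially"
      using complete M.mcomplete_def by blast
    then have l: "l \<in> carrier A" "\<And>e. e > 0 \<Longrightarrow> \<exists>N. \<forall>n\<ge>N. ndist A (s n) l < e"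
      unfolding M.limit_metric_sequentially by blast+
    have sA: "s n \<in> carrier A" for n using sS S(1) by blast
    have lS: "l \<in> S"
    proof (rule lim[of s])
      show "\<exists>N. \<forall>n\<ge>N. nrm A (s n \<ominus> l) < e" if "e > 0" for e
        using l(2)[OF that] sA l(1) by (simp add: ndist_def)
    qed (use sS l(1) in auto)
    have "limitin SM.mtopology s l sequentially"
      unfolding SM.limit_metric_sequentially using l lS sS dist by auto
    then show "\<exists>l. limitin SM.mtopology s l sequentially" ..
  qed
  then show ?thesis
    using S closed
    by (intro cstar_algebra.intro[OF mod] cstar_algebra_axioms.intro)
       (auto simp: subset_iff mult_assoc distr_left distr_right smult_mult_left smult_mult_right
         adj_adj adj_add adj_smult adj_mult nrm_nonneg nrm_eq_0_iff nrm_triangle nrm_smult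
         nrm_mult nrm_cstar)
qed

text \<open>Property SP will be applied to this subalgebra to obtain spectral projections. It is
  closed because multiplication by \<open>d\<close> is continuous, and heredity is
  \<open>annihilator_order\<close> carried over by \<open>emb\<close>.\<close>

lemma hereditary_annihilator:
  fixes A :: "'a cstar"
  assumes A: "unital_cstar_algebra A" and d: "d \<in> carrier A" "adj A d = d"
  shows "hereditary_subalgebra
    (A\<lparr>carrier := {x \<in> carrier A. x \<otimes>\<^bsub>A\<^esub> d = \<zero>\<^bsub>A\<^esub> \<and> d \<otimes>\<^bsub>A\<^esub> x = \<zero>\<^bsub>A\<^esub>}\<rparr>) A"
proof -
  interpret unital_cstar_algebra A by (rule A)

  define S where "S = {x \<in> carrier A. x \<otimes>\<^bsub>A\<^esub> d = \<zero>\<^bsub>A\<^esub> \<and> d \<otimes>\<^bsub>A\<^esub> x = \<zero>\<^bsub>A\<^esub>}"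
  have lim0: "z = \<zero>\<^bsub>A\<^esub>" if z: "z \<in> carrier A"
    and small: "\<And>e. e > 0 \<Longrightarrow> \<exists>v<e. nrm A z \<le> v * nrm A d" for z
  proof (rule ccontr)
    assume "z \<noteq> \<zero>\<^bsub>A\<^esub>"
    then have pos: "nrm A z > 0" using nrm_eq_0_iff[OF z] nrm_nonneg[OF z] by linarith
    \<comment> \<open>The summand 1 keeps the denominator positive when \<open>d\<close> is
      zero.\<close>
    define e where "e = nrm A z / (nrm A d + 1)"
    have "e > 0" using pos nrm_nonneg[OF d(1)] by (simp add: e_def)
    then obtain v where x: "v < e" "nrm A z \<le> v * nrm A d"
      using small by blast
    have "v * nrm A d \<le> e * nrm A d"
      using x nrm_nonneg[OF d(1)] by (intro mult_right_mono) auto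
    also have "\<dots> < e * (nrm A d + 1)" using \<open>e > 0\<close> by simp
    also have "\<dots> = nrm A z" using nrm_nonneg[OF d(1)] by (simp add: e_def)
    finally show False using x by simp
  qed
  have adjS: "adj A x \<in> S" if "x \<in> S" for x
  proof -
    have "d \<otimes>\<^bsub>A\<^esub> adj A x = adj A (x \<otimes>\<^bsub>A\<^esub> d)" "adj A x \<otimes>\<^bsub>A\<^esub> d = adj A (d \<otimes>\<^bsub>A\<^esub> x)"
      using that d adj_mult[of x d] adj_mult[of d x] by (simp_all add: S_def del: adj_zero)
    then show ?thesis using that by (simp add: S_def)
  qed
  have alg: "cstar_algebra (A\<lparr>carrier := S\<rparr>)"
  proof (rule cstar_algebra_restrict)
    show "x \<otimes>\<^bsub>A\<^esub> y \<in> S" if "x \<in> S" "y \<in> S" for x y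
      using that d mult_assoc[of x y d] mult_assoc[of d x y] by (simp add: S_def)
    show "l \<in> S" if s: "\<And>n::nat. s n \<in> S" and l: "l \<in> carrier A"
      and lim: "\<And>e. e > 0 \<Longrightarrow> \<exists>N. \<forall>n\<ge>N. nrm A (s n \<ominus>\<^bsub>A\<^esub> l) < e" for s l
    proof -
      have sn: "s n \<in> carrier A" "emb A (s n) * emb A d = 0" "emb A d * emb A (s n) = 0" for n
        using s[of n] d by (auto simp: S_def emb_zero[OF A] simp flip: emb_mult[OF A])
      have est: "nrm A (l \<otimes>\<^bsub>A\<^esub> d) \<le> nrm A (s n \<ominus>\<^bsub>A\<^esub> l) * nrm A d"
          "nrm A (d \<otimes>\<^bsub>A\<^esub> l) \<le> nrm A (s n \<ominus>\<^bsub>A\<^esub> l) * nrm A d" for n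
      proof -
        have "(emb A (s n) - emb A l) * emb A d = - emb A (l \<otimes>\<^bsub>A\<^esub> d)"
          "emb A d * (emb A (s n) - emb A l) = - emb A (d \<otimes>\<^bsub>A\<^esub> l)"
          using sn[of n] l d by (simp_all add: left_diff_distrib right_diff_distrib emb_mult[OF A])
        then have "norm (emb A (l \<otimes>\<^bsub>A\<^esub> d)) \<le> norm (emb A (s n) - emb A l) * norm (emb A d)"
          "norm (emb A (d \<otimes>\<^bsub>A\<^esub> l)) \<le> norm (emb A d) * norm (emb A (s n) - emb A l)"
          by (metis norm_minus_cancel norm_mult_ineq)+
        then show "nrm A (l \<otimes>\<^bsub>A\<^esub> d) \<le> nrm A (s n \<ominus>\<^bsub>A\<^esub> l) * nrm A d"
          "nrm A (d \<otimes>\<^bsub>A\<^esub> l) \<le> nrm A (s n \<ominus>\<^bsub>A\<^esub> l) * nrm A d"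
          using sn(1)[of n] l d
          by (simp_all add: norm_emb[OF A] mult.commute flip: emb_diff[OF A])
      qed
      have "\<exists>n. nrm A (s n \<ominus>\<^bsub>A\<^esub> l) < e" if "e > 0" for e
        using lim[OF that] by blast
      with est have "\<exists>v<e. nrm A (l \<otimes>\<^bsub>A\<^esub> d) \<le> v * nrm A d" "\<exists>v<e. nrm A (d \<otimes>\<^bsub>A\<^esub> l) \<le> v * nrm A d"
        if "e > 0" for e
        using that by blast+
      then have "l \<otimes>\<^bsub>A\<^esub> d = \<zero>\<^bsub>A\<^esub>" "d \<otimes>\<^bsub>A\<^esub> l = \<zero>\<^bsub>A\<^esub>"
        using l d(1) lim0 mult_closed by presburger+
      then show ?thesis using l by (simp add: S_def)
    qed
  qed (use d adjS in \<open>auto simp: S_def distr_left distr_right smult_mult_left smult_mult_right\<close>)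
  have her: "x \<in> S" if x: "x \<in> carrier A" "y \<in> S" and le: "cstar_le A \<zero>\<^bsub>A\<^esub> x" "cstar_le A x y" for x y
  proof -
    have y: "y \<in> carrier A" "emb A y * emb A d = 0"
      using that d by (auto simp: S_def emb_zero[OF A] simp flip: emb_mult[OF A])
    have px: "posi (emb A x)" using posi_emb_if_le[OF A le(1)] emb_zero[OF A] by simp
    have "emb A x * emb A d = 0"
      using annihilator_order[OF _ y(2) px posi_emb_if_le[OF A le(2)]] d emb_adj[OF A, of d] by simp
    then have 1: "x \<otimes>\<^bsub>A\<^esub> d = \<zero>\<^bsub>A\<^esub>"
      using x d emb_eq_0_iff[OF A, of "x \<otimes>\<^bsub>A\<^esub> d"] by (simp add: emb_mult[OF A])
    have "adj A x = x"
    proof -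
      from le(1) obtain s where "s \<in> carrier A" "x \<ominus>\<^bsub>A\<^esub> \<zero>\<^bsub>A\<^esub> = adj A s \<otimes>\<^bsub>A\<^esub> s"
        unfolding cstar_le_def positive_def by blast
      then show ?thesis using x by (simp add: a_minus_eq_smult adj_mult adj_adj)
    qed
    then have "d \<otimes>\<^bsub>A\<^esub> x = \<zero>\<^bsub>A\<^esub>" using adj_mult[of x d] x d 1 by simp
    with 1 x show ?thesis by (simp add: S_def)
  qed
  have "S \<subseteq> carrier A" by (auto simp: S_def)
  with alg have "cstar_subalgebra (A\<lparr>carrier := S\<rparr>) A"
    by (simp add: cstar_subalgebra_def)
  moreover have "\<forall>x\<in>carrier A. \<forall>y\<in>S. cstar_le A \<zero>\<^bsub>A\<^esub> x \<and> cstar_le A x y \<longrightarrow> x \<in> S"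
    using her by blast
  ultimately have "hereditary_subalgebra (A\<lparr>carrier := S\<rparr>) A"
    by (simp add: hereditary_subalgebra_def)
  then show ?thesis by (simp only: S_def)
qed

text \<open>For \<open>d\<close> and \<open>h\<close> from \<open>spectral_cut\<close>, the
  annihilator of \<open>d\<close> in \<open>B\<close> is hereditary and contains the non-zero
  \<open>h\<close>. Property SP therefore supplies a projection \<open>q\<close> with
  \<open>q d = 0\<close>, to which the norm bound of the cut applies.\<close>

lemma SP_spectral_projection:
  fixes B :: "'a cstar"
  assumes B: "unital_cstar_algebra B" and SP: "property_SP B"
    and x: "x \<in> carrier B" "x \<noteq> \<zero>\<^bsub>B\<^esub>"
  defines "b \<equiv> adj B x \<otimes>\<^bsub>B\<^esub> x"
  obtains q where "projection B q" "q \<noteq> \<zero>\<^bsub>B\<^esub>"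
    "nrm B (complex_of_real (nrm B b) \<odot>\<^bsub>B\<^esub> q \<ominus>\<^bsub>B\<^esub> q \<otimes>\<^bsub>B\<^esub> b \<otimes>\<^bsub>B\<^esub> q) \<le> nrm B b / 2"
proof -
  interpret unital_cstar_algebra B by (rule B)
  note emb_simps = emb_scaleR[OF B] emb_mult[OF B] emb_adj[OF B] emb_diff[OF B] norm_emb[OF B]
    emb_eq_0_iff[OF B]
  define u where "u = emb B \<one>\<^bsub>B\<^esub>"
  have u: "star u = u" "u * u = u" "emb B x * u = emb B x"
    using x emb_one_mult[OF B] star_emb_one[OF B] by (auto simp: u_def)
  have bc: "b \<in> carrier B" using x by (simp add: b_def)
  have b: "emb B b = star (emb B x) * emb B x" using x by (simp add: b_def emb_simps)
  have x0: "emb B x \<noteq> 0" using x by (simp add: emb_simps)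
  obtain d h where dh: "star d = d" "star h = h" "d * h = 0" "h \<noteq> 0" "d * u = d" "h * u = h"
    and cut: "\<And>q. star q = q \<Longrightarrow> q * q = q \<Longrightarrow> q * u = q \<Longrightarrow> q * d = 0
      \<Longrightarrow> norm (norm (emb B b) *\<^sub>R q - q * emb B b * q) \<le> norm (emb B b) / 2"
    using spectral_cut[OF u x0 b] by blast
  \<comment> \<open>\<open>d\<close> and \<open>h\<close> arise in the product, but being fixed by
    the image \<open>u\<close> of the unit they come from elements of \<open>B\<close>.\<close>
  define d' h' where "d' = coord d B" and "h' = coord h B"
  have d': "d' \<in> carrier B" "adj B d' = d'" "emb B d' = d"
    using B dh(1,5) emb_coord[OF B, of d] by (auto simp: d'_def u_def simp flip: coord_star)
  have h': "h' \<in> carrier B" "h' \<noteq> \<zero>\<^bsub>B\<^esub>"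
    using B dh(4,6) emb_coord[OF B, of h] by (auto simp: h'_def u_def)
  have "h * d = 0" using arg_cong[OF dh(3), of star] dh(1,2) by simp
  then have "d' \<otimes>\<^bsub>B\<^esub> h' = \<zero>\<^bsub>B\<^esub>" "h' \<otimes>\<^bsub>B\<^esub> d' = \<zero>\<^bsub>B\<^esub>"
    using dh(3) B by (auto simp: d'_def h'_def simp flip: coord_mult)
  then obtain q where q: "q \<otimes>\<^bsub>B\<^esub> d' = \<zero>\<^bsub>B\<^esub>" "projection B q" "q \<noteq> \<zero>\<^bsub>B\<^esub>"
    using SP hereditary_annihilator[OF B d'(1,2)] h' unfolding property_SP_def by fastforce
  have qc: "q \<in> carrier B" "adj B q = q" "q \<otimes>\<^bsub>B\<^esub> q = q"
    using q(2) by (auto simp: projection_def)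
  have "norm (norm (emb B b) *\<^sub>R emb B q - emb B q * emb B b * emb B q) \<le> norm (emb B b) / 2"
  proof (rule cut)
    show "star (emb B q) = emb B q" "emb B q * emb B q = emb B q"
      using qc by (simp_all flip: emb_adj[OF B] emb_mult[OF B])
    show "emb B q * u = emb B q" using qc emb_one_mult[OF B] by (simp add: u_def)
    show "emb B q * d = 0"
      using qc d' q(1) by (simp flip: d'(3) add: emb_zero[OF B] flip: emb_mult[OF B])
  qed
  then have "nrm B (complex_of_real (nrm B b) \<odot>\<^bsub>B\<^esub> q \<ominus>\<^bsub>B\<^esub> q \<otimes>\<^bsub>B\<^esub> b \<otimes>\<^bsub>B\<^esub> q) \<le> nrm B b / 2"
    using qc bc by (simp flip: emb_simps(1,2,4) add: norm_emb[OF B])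
  then show ?thesis using that q by blast
qed

text \<open>\<open>projection_below_square\<close> is carried out in the product and its projection
  \<open>p\<close> is brought back to \<open>A\<close>. There \<open>0 <= p' <= t y^2\<close> with
  \<open>y^2\<close> in \<open>H\<close>, so heredity applies.\<close>

lemma hereditary_projection:
  fixes A :: "'a cstar"
  assumes A: "unital_cstar_algebra A" and H: "hereditary_subalgebra H A"
    and y: "y \<in> carrier H" "adj A y = y" and c: "c \<in> carrier A" "adj A c = c"
    and q: "projection A q" "q \<noteq> \<zero>\<^bsub>A\<^esub>" and b: "0 < \<beta>"
    and small: "norm (\<beta> *\<^sub>R emb A q - emb A q * emb A c * emb A y * emb A y * emb A c * emb A q) < \<beta>"
  obtains p where "p \<in> carrier H" "projection A p" "p \<noteq> \<zero>\<^bsub>A\<^esub>"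
proof -
  interpret unital_cstar_algebra A by (rule A)
  have sub: "cstar_subalgebra H A" using H by (simp add: hereditary_subalgebra_def)
  then interpret H: cstar_algebra H by (simp add: cstar_subalgebra_def)
  have yA: "y \<in> carrier A" using sub y by (auto simp: cstar_subalgebra_def)
  have qc: "q \<in> carrier A" "adj A q = q" "q \<otimes>\<^bsub>A\<^esub> q = q"
    using q(1) by (auto simp: projection_def)
  define Y where "Y = emb A y"
  have sY: "star Y = Y" using y yA by (simp add: Y_def flip: emb_adj[OF A])
  have Y: "Y * emb A \<one>\<^bsub>A\<^esub> = Y" "coord Y A = y"
    using yA emb_one_mult[OF A] coord_emb_self[OF A] by (auto simp: Y_def)
  obtain p m s t where p: "star p = p" "p * p = p" "p \<noteq> 0" "p = Y * m * Y"
    and le: "t *\<^sub>R (Y * Y) - p = star (s * Y) * (s * Y)"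
  proof (rule projection_below_square[OF sY _ _ _ _ b])
    show "star (emb A c) = emb A c" using c by (simp flip: emb_adj[OF A])
    show "star (emb A q) = emb A q" "emb A q * emb A q = emb A q"
      using qc by (simp_all flip: emb_adj[OF A] emb_mult[OF A])
    show "emb A q \<noteq> 0" using q qc by (simp add: emb_eq_0_iff[OF A])
    show "norm (\<beta> *\<^sub>R emb A q - emb A q * emb A c * Y * Y * emb A c * emb A q) < \<beta>"
      using small by (simp add: Y_def)
  qed
  define p' where "p' = coord p A"
  have p': "p' \<in> carrier A" "adj A p' = p'" "p' \<otimes>\<^bsub>A\<^esub> p' = p'"
    using A p by (auto simp: p'_def simp flip: coord_star coord_mult)
  have "emb A p' = p" unfolding p'_def
    by (rule emb_coord[OF A]) (simp add: p(4) mult.assoc Y)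
  then have p0: "p' \<noteq> \<zero>\<^bsub>A\<^esub>" using p(3) emb_zero[OF A] by auto
  have "cstar_le A \<zero>\<^bsub>A\<^esub> p'"
    using p' by (auto simp: cstar_le_def positive_def a_minus_eq_smult intro!: bexI[of _ p'])
  moreover have "cstar_le A p' (complex_of_real t \<odot>\<^bsub>A\<^esub> (y \<otimes>\<^bsub>A\<^esub> y))"
    unfolding cstar_le_def positive_def
  proof (intro conjI bexI)
    \<comment> \<open>The coordinate map at \<open>A\<close> is a *-homomorphism, so it sends the
      witness \<open>s * Y\<close> from the product to a witness in \<open>A\<close>.\<close>
    show "complex_of_real t \<odot>\<^bsub>A\<^esub> (y \<otimes>\<^bsub>A\<^esub> y) \<ominus>\<^bsub>A\<^esub> p' = adj A (coord (s * Y) A) \<otimes>\<^bsub>A\<^esub> coord (s * Y) A"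
      using arg_cong[OF le, of "\<lambda>f. coord f A"] A yA by (simp add: Y p'_def adj_mult)
  qed (use A p' yA in auto)
  moreover have "complex_of_real t \<odot>\<^bsub>A\<^esub> (y \<otimes>\<^bsub>A\<^esub> y) \<in> carrier H"
  proof -
    have yy: "y \<otimes>\<^bsub>H\<^esub> y \<in> carrier H" using y by simp
    moreover have "y \<otimes>\<^bsub>H\<^esub> y = y \<otimes>\<^bsub>A\<^esub> y" using sub y by (simp add: cstar_subalgebra_def)
    moreover have "complex_of_real t \<odot>\<^bsub>H\<^esub> (y \<otimes>\<^bsub>H\<^esub> y) = complex_of_real t \<odot>\<^bsub>A\<^esub> (y \<otimes>\<^bsub>H\<^esub> y)"
      using sub yy by (auto simp: cstar_subalgebra_def)
    ultimately show ?thesis using H.smult_carrier by metis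
  qed
  ultimately have "p' \<in> carrier H"
    using H p'(1) unfolding hereditary_subalgebra_def by blast
  then show ?thesis using that p' p0 by (auto simp: projection_def)
qed

text \<open>A normalised \<open>w* w\<close> is self-adjoint, and the C*-identity ensures that it is
  non-zero before normalisation.\<close>

lemma hereditary_norm_one_element:
  fixes A :: "'a cstar"
  assumes A: "unital_cstar_algebra A" and H: "cstar_subalgebra H A" and ne: "carrier H \<noteq> {\<zero>\<^bsub>A\<^esub>}"
  obtains y where "y \<in> carrier H" "adj A y = y" "nrm A y = 1"
proof -
  interpret unital_cstar_algebra A by (rule A)
  interpret H: cstar_algebra H using H by (simp add: cstar_subalgebra_def)
  have zero: "\<zero>\<^bsub>H\<^esub> = \<zero>\<^bsub>A\<^esub>" using H by (simp add: cstar_subalgebra_def)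
  then obtain w where w: "w \<in> carrier H" "w \<noteq> \<zero>\<^bsub>H\<^esub>" using ne H.M.zero_closed by auto
  define x where "x = adj H w \<otimes>\<^bsub>H\<^esub> w"
  have x: "x \<in> carrier H" "adj H x = x" using w by (simp_all add: x_def H.adj_mult H.adj_adj)
  have nx: "nrm H x > 0"
    using w H.nrm_cstar[of w] H.nrm_eq_0_iff[of w] by (simp add: x_def)
  define y where "y = complex_of_real (1 / nrm H x) \<odot>\<^bsub>H\<^esub> x"
  have "y \<in> carrier H" "adj H y = y" "nrm H y = 1"
    using x nx by (simp_all add: y_def H.adj_smult H.nrm_smult norm_divide)
  then show ?thesis using that H by (auto simp: cstar_subalgebra_def)
qed

section \<open>Transfer of property SP from the approximating subalgebra to \<open>A\<close>\<close>

theorem theorem3p1: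
  fixes \<Omega> :: "'a cstar set" and A :: "'a cstar"
  assumes "\<And>B. B \<in> \<Omega> \<Longrightarrow> unital_cstar_algebra B"
    and "\<And>B. B \<in> \<Omega> \<Longrightarrow> property_SP B"
    and "unital_cstar_algebra A" and "simple_cstar A"
    and "A \<in> WTA \<Omega>"
  shows "property_SP A"
  unfolding property_SP_def
proof (intro allI impI, elim conjE)
  fix H :: "'a cstar"
  assume H: "hereditary_subalgebra H A" and ne: "carrier H \<noteq> {\<zero>\<^bsub>A\<^esub>}"
  note A = assms(3)
  interpret unital_cstar_algebra A by (rule A)
  have sub: "cstar_subalgebra H A" using H by (simp add: hereditary_subalgebra_def)
  obtain y where y: "y \<in> carrier H" "adj A y = y" "nrm A y = 1"
    using hereditary_norm_one_element[OF A sub ne] by blast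
  have yA: "y \<in> carrier A" using sub y by (auto simp: cstar_subalgebra_def)
  define a where "a = y \<otimes>\<^bsub>A\<^esub> y"
  have a: "a \<in> carrier A" "nrm A a = 1" "a \<noteq> \<zero>\<^bsub>A\<^esub>" "positive A a"
    using yA y nrm_cstar[of y] nrm_eq_0_iff[of y] by (auto simp: a_def positive_def intro!: bexI[of _ y])
  \<comment> \<open>The tolerance 1/10 is the one for which \<open>star_mult_close\<close> has been
    computed.\<close>
  have "\<exists>p g. \<exists>B\<in>\<Omega>. projection A p \<and> g \<in> carrier A \<and> cstar_le A \<zero>\<^bsub>A\<^esub> g \<and> cstar_le A g \<one>\<^bsub>A\<^esub> \<and>
      cstar_subalgebra B A \<and> g \<in> carrier B \<and> \<one>\<^bsub>B\<^esub> = p \<and>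
      near A (y \<otimes>\<^bsub>A\<^esub> (p \<ominus>\<^bsub>A\<^esub> g)) (1/10) (carrier B) \<and>
      nrm A ((p \<ominus>\<^bsub>A\<^esub> g) \<otimes>\<^bsub>A\<^esub> a \<otimes>\<^bsub>A\<^esub> (p \<ominus>\<^bsub>A\<^esub> g)) \<ge> nrm A a - 1/10"
  proof -
    have "\<forall>\<epsilon>>0. \<forall>F a. finite F \<and> F \<subseteq> carrier A \<and> a \<in> carrier A \<and> a \<noteq> \<zero>\<^bsub>A\<^esub> \<and> positive A a \<longrightarrow>
      (\<exists>p g. \<exists>B\<in>\<Omega>. projection A p \<and> g \<in> carrier A \<and>
        cstar_le A \<zero>\<^bsub>A\<^esub> g \<and> cstar_le A g \<one>\<^bsub>A\<^esub> \<and>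
        unital_cstar_algebra B \<and> cstar_subalgebra B A \<and> g \<in> carrier B \<and> \<one>\<^bsub>B\<^esub> = p \<and>
        (\<forall>x\<in>F. near A ((p \<ominus>\<^bsub>A\<^esub> g) \<otimes>\<^bsub>A\<^esub> x) \<epsilon> (carrier B) \<and>
               near A (x \<otimes>\<^bsub>A\<^esub> (p \<ominus>\<^bsub>A\<^esub> g)) \<epsilon> (carrier B)) \<and>
        (\<forall>x\<in>F. nrm A ((p \<ominus>\<^bsub>A\<^esub> g) \<otimes>\<^bsub>A\<^esub> x \<ominus>\<^bsub>A\<^esub> x \<otimes>\<^bsub>A\<^esub> (p \<ominus>\<^bsub>A\<^esub> g)) < \<epsilon>) \<and>
        cuntz_sub A (corner A (\<one>\<^bsub>A\<^esub> \<ominus>\<^bsub>A\<^esub> (p \<ominus>\<^bsub>A\<^esub> g))) (corner A a) \<and>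
        nrm A ((p \<ominus>\<^bsub>A\<^esub> g) \<otimes>\<^bsub>A\<^esub> a \<otimes>\<^bsub>A\<^esub> (p \<ominus>\<^bsub>A\<^esub> g)) \<ge> nrm A a - \<epsilon>)"
      using assms(5) unfolding WTA_def by blast
    from this[rule_format, of "1/10" "{y}" a] show ?thesis using a yA by auto
  qed
  then obtain p g B where B: "B \<in> \<Omega>" "cstar_subalgebra B A"
    and p: "projection A p" and g: "cstar_le A \<zero>\<^bsub>A\<^esub> g" "cstar_le A g \<one>\<^bsub>A\<^esub>"
    and gB: "g \<in> carrier B" "\<one>\<^bsub>B\<^esub> = p"
    and near: "near A (y \<otimes>\<^bsub>A\<^esub> (p \<ominus>\<^bsub>A\<^esub> g)) (1/10) (carrier B)"
    and large: "nrm A ((p \<ominus>\<^bsub>A\<^esub> g) \<otimes>\<^bsub>A\<^esub> a \<otimes>\<^bsub>A\<^esub> (p \<ominus>\<^bsub>A\<^esub> g)) \<ge> nrm A a - 1/10" by blast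
  interpret B: unital_cstar_algebra B by (rule assms(1)[OF B(1)])
  have BA: "carrier B \<subseteq> carrier A" "\<zero>\<^bsub>B\<^esub> = \<zero>\<^bsub>A\<^esub>"
      "\<And>x y. x \<in> carrier B \<Longrightarrow> y \<in> carrier B \<Longrightarrow> x \<oplus>\<^bsub>B\<^esub> y = x \<oplus>\<^bsub>A\<^esub> y"
      "\<And>x y. x \<in> carrier B \<Longrightarrow> y \<in> carrier B \<Longrightarrow> x \<otimes>\<^bsub>B\<^esub> y = x \<otimes>\<^bsub>A\<^esub> y"
      "\<And>c x. x \<in> carrier B \<Longrightarrow> c \<odot>\<^bsub>B\<^esub> x = c \<odot>\<^bsub>A\<^esub> x"
      "\<And>x. x \<in> carrier B \<Longrightarrow> adj B x = adj A x" "\<And>x. x \<in> carrier B \<Longrightarrow> nrm B x = nrm A x"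
    using B(2) by (auto simp: cstar_subalgebra_def)
  \<comment> \<open>Subtraction is not among the operations compared in
    \<open>cstar_subalgebra\<close>, so it is rewritten as addition of a multiple by -1.\<close>
  have minus: "x \<ominus>\<^bsub>B\<^esub> y = x \<ominus>\<^bsub>A\<^esub> y" if "x \<in> carrier B" "y \<in> carrier B" for x y
    using that BA(1) B.smult_carrier[OF that(2), of "- 1"]
    by (simp add: B.a_minus_eq_smult a_minus_eq_smult BA(3,5) subset_iff)
  have pc: "p \<in> carrier A" "adj A p = p" "p \<otimes>\<^bsub>A\<^esub> p = p" using p by (auto simp: projection_def)
  have pg: "p \<otimes>\<^bsub>A\<^esub> g = g" "g \<otimes>\<^bsub>A\<^esub> p = g"
    using B.l_one[OF gB(1)] B.r_one[OF gB(1)] BA(4) B.one_closed gB by metis+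
  have gc: "g \<in> carrier A" using BA gB by auto
  have "posi (emb A g)" using posi_emb_if_le[OF A g(1)] emb_zero[OF A] by simp
  note g_posi = this posi_emb_if_le[OF A g(2)]
  define c where "c = p \<ominus>\<^bsub>A\<^esub> g"
  have cc: "c \<in> carrier A" using pc gc by (simp add: c_def)
  have ec: "emb A c = emb A p - emb A g" using pc gc emb_diff[OF A] by (simp add: c_def)
  have sp: "star (emb A p) = emb A p" using pc by (simp flip: emb_adj[OF A])
  have sc: "star (emb A c) = emb A c" using sp posi_sa[OF g_posi(1)] by (simp add: ec)
  have norm_c: "norm (emb A c) \<le> 1"
    unfolding ec
  proof (rule norm_projection_minus_le[OF sp])
    show "emb A p * emb A p = emb A p" "emb A p * emb A g = emb A g" "emb A g * emb A p = emb A g"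
      using pc gc pg by (simp_all flip: emb_mult[OF A])
    show "emb A \<one>\<^bsub>A\<^esub> * emb A p = emb A p" using pc emb_one_mult[OF A] by simp
  qed (use g_posi in auto)
  have ac: "adj A c = c"
    using sc cc by (metis A adj_closed coord_emb_self emb_adj)
  obtain x where x: "x \<in> carrier B" "nrm A (y \<otimes>\<^bsub>A\<^esub> c \<ominus>\<^bsub>A\<^esub> x) < 1/10"
    using near by (auto simp: near_def c_def)
  have xA: "x \<in> carrier A" using x BA by auto
  \<comment> \<open>\<open>star k * k\<close> is the image of \<open>c a c\<close>, whose norm the
    last clause of \<open>WTA\<close> bounds from below. The nearness clause for \<open>y c\<close>
    places \<open>k\<close> within 1/10 of the image of \<open>x\<close> in
    \<open>B\<close>.\<close>
  define k where "k = emb A y * emb A c"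
  have sy: "star (emb A y) = emb A y" using y yA by (simp flip: emb_adj[OF A])
  have kk: "star k * k = emb A c * emb A y * emb A y * emb A c" by (simp add: k_def sy sc mult.assoc)
  have "norm k \<le> 1 * 1"
    using norm_mult_ineq[of "emb A y" "emb A c"] norm_c y yA norm_emb[OF A yA] by (simp add: k_def)
  moreover have "9/10 \<le> (norm k)\<^sup>2"
  proof -
    have "star k * k = emb A (c \<otimes>\<^bsub>A\<^esub> a \<otimes>\<^bsub>A\<^esub> c)"
      using cc yA by (simp add: kk a_def emb_mult[OF A] mult.assoc)
    then have "(norm k)\<^sup>2 = nrm A (c \<otimes>\<^bsub>A\<^esub> a \<otimes>\<^bsub>A\<^esub> c)"
      using norm_star_mult[of k] norm_emb[OF A, of "c \<otimes>\<^bsub>A\<^esub> a \<otimes>\<^bsub>A\<^esub> c"] cc a(1) by simp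
    then show ?thesis using large a by (simp add: c_def)
  qed
  moreover have "norm (k - emb A x) < 1/10"
    using x xA yA cc by (simp add: k_def flip: emb_mult[OF A] emb_diff[OF A] add: norm_emb[OF A])
  ultimately have close: "norm (star (emb A x) * emb A x - star k * k)
      < norm (star (emb A x) * emb A x) / 2"
    by (intro star_mult_close) auto
  define b where "b = adj B x \<otimes>\<^bsub>B\<^esub> x"
  have b: "b \<in> carrier B" using x(1) by (simp add: b_def)
  have b_eq: "b = adj A x \<otimes>\<^bsub>A\<^esub> x"
    using BA(4)[OF B.adj_closed[OF x(1)] x(1)] by (simp add: b_def BA(6)[OF x(1)])
  have eb: "emb A b = star (emb A x) * emb A x" using xA emb_mult[OF A] emb_adj[OF A] by (simp add: b_eq)
  define \<beta> where "\<beta> = nrm B b"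
  have \<beta>: "\<beta> = norm (emb A b)" using b BA norm_emb[OF A] by (auto simp: \<beta>_def)
  have "\<beta> > 0"
    using close norm_ge_zero[of "star (emb A x) * emb A x - star k * k"] unfolding \<beta> eb by linarith
  have "x \<noteq> \<zero>\<^bsub>B\<^esub>" using \<open>\<beta> > 0\<close> emb_zero[OF A] BA(2) by (auto simp: \<beta> eb)
  then obtain q where q: "projection B q" "q \<noteq> \<zero>\<^bsub>B\<^esub>"
      "nrm B (complex_of_real \<beta> \<odot>\<^bsub>B\<^esub> q \<ominus>\<^bsub>B\<^esub> q \<otimes>\<^bsub>B\<^esub> b \<otimes>\<^bsub>B\<^esub> q) \<le> \<beta> / 2"
    using SP_spectral_projection[OF assms(1)[OF B(1)] assms(2)[OF B(1)] x(1)] unfolding \<beta>_def b_def by blast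
  have qB: "q \<in> carrier B" using q(1) by (simp add: projection_def)
  then have qA: "q \<in> carrier A" using BA by auto
  have q': "projection A q" using q(1) qA qB BA by (auto simp: projection_def)
  have Q: "star (emb A q) = emb A q" "emb A q * emb A q = emb A q"
    using q' by (auto simp: projection_def simp flip: emb_adj[OF A] emb_mult[OF A])
  have bA: "b \<in> carrier A" using b BA by auto
  have "nrm A (complex_of_real \<beta> \<odot>\<^bsub>A\<^esub> q \<ominus>\<^bsub>A\<^esub> q \<otimes>\<^bsub>A\<^esub> b \<otimes>\<^bsub>A\<^esub> q) \<le> \<beta> / 2"
  proof -
    define v w where "v = complex_of_real \<beta> \<odot>\<^bsub>B\<^esub> q" and "w = q \<otimes>\<^bsub>B\<^esub> b \<otimes>\<^bsub>B\<^esub> q"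
    have vw: "v \<in> carrier B" "w \<in> carrier B" using qB b by (simp_all add: v_def w_def)
    have "v = complex_of_real \<beta> \<odot>\<^bsub>A\<^esub> q" "w = q \<otimes>\<^bsub>A\<^esub> b \<otimes>\<^bsub>A\<^esub> q"
      using BA(5)[OF qB] BA(4)[OF qB b] BA(4)[OF B.mult_closed[OF qB b] qB] by (simp_all add: v_def w_def)
    moreover have "nrm A (v \<ominus>\<^bsub>A\<^esub> w) \<le> \<beta> / 2"
      using q(3) BA(7)[of "v \<ominus>\<^bsub>B\<^esub> w"] vw minus[OF vw] B.minus_closed[OF vw] by (simp add: v_def w_def)
    ultimately show ?thesis by simp
  qed
  then have 1: "norm (\<beta> *\<^sub>R emb A q - emb A q * emb A b * emb A q) \<le> \<beta> / 2"
    using qA bA by (simp flip: emb_scaleR[OF A] emb_mult[OF A] emb_diff[OF A] add: norm_emb[OF A])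
  have "norm (emb A q * (emb A b - star k * k) * emb A q) \<le> 1 * norm (emb A b - star k * k) * 1"
    using norm_projection_le[OF Q]
    by (meson mult_mono norm_mult_ineq norm_ge_zero order_trans order_refl zero_le_one mult_nonneg_nonneg)
  then have 2: "norm (emb A q * (emb A b - star k * k) * emb A q) < \<beta> / 2"
    using close by (simp add: \<beta> eb)
  \<comment> \<open>Two errors are added: at most \<open>\<beta>/2\<close> from the spectral
    projection and strictly less than \<open>\<beta>/2\<close> from replacing \<open>b\<close> by
    \<open>c a c\<close>. Their sum stays below \<open>\<beta>\<close>, as
    \<open>hereditary_projection\<close> requires.\<close>
  have 3: "\<beta> *\<^sub>R emb A q - emb A q * (star k * k) * emb A q =
      (\<beta> *\<^sub>R emb A q - emb A q * emb A b * emb A q) + emb A q * (emb A b - star k * k) * emb A q"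
    by (simp add: algebra_simps)
  have "norm (\<beta> *\<^sub>R emb A q - emb A q * (star k * k) * emb A q) < \<beta>"
    unfolding 3
    using 1 2 norm_triangle_ineq[of "\<beta> *\<^sub>R emb A q - emb A q * emb A b * emb A q"
        "emb A q * (emb A b - star k * k) * emb A q"] by linarith
  then have "norm (\<beta> *\<^sub>R emb A q - emb A q * emb A c * emb A y * emb A y * emb A c * emb A q) < \<beta>"
    by (simp add: kk mult.assoc)
  then show "\<exists>q\<in>carrier H. projection A q \<and> q \<noteq> \<zero>\<^bsub>A\<^esub>"
    using hereditary_projection[OF A H y(1,2) cc ac q' _ \<open>\<beta> > 0\<close>] q(2) BA(2) by metis
qed

end
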